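(* Let $k$ be a fixed positive integer and $\sigma^2>0$. Let $\{X_n\in\mathbb{R}^{d_n},\,n\ge1\}$ be continuous random vectors satisfying the following conditions, where $\widetilde X_n$ denotes an independent copy of $X_n$: (1) $\|X_n\|^2\to\sigma^2$ in probability as $n\to\infty$; (2) $X_n'\widetilde X_n\to0$ in probability as $n\to\infty$; (3) there exists a positive integer $n_0$ such that $\mathbb{E}[(\det A_{n_0,k})^{-1/2}]<\infty$; (4) for each $n$, $\int_{-\infty}^\infty|\varphi_{X_n}(t\theta)|\,dt<\infty$ for almost all $\theta\in\mathcal{S}^{d_n-1}$. Let $\Xi_n\sim\mathcal{N}_{d_n}(0,I_{d_n})$, $n\ge1$, suppose that $\{\Xi_n,\,n\ge1\}$ and $\{X_n,\,n\ge1\}$ are independent, and let $Y_n=\Xi_n'X_n$. Then for all $0<p<2\lfloor k/2\rfloor$, $$\lim_{n\to\infty}\,\sup_{y\in\mathbb{R}}\,\mathbb{E}_{\Xi_n}\big|F_{Y_n|\Xi_n}(y)-F_{\mathcal{N}_1(0,\sigma^2)}(y)\big|^p=0.$$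
   Context: Conventions: vectors are column vectors, $'$ denotes transpose, $\|\cdot\|$ is the Euclidean norm. The dimensions $d_1,d_2,\ldots$ form a monotonically increasing sequence of positive integers with $d_n\to\infty$. All random vectors $X_n$, $\Xi_n$ are continuous with continuous density functions, each density being supported on an open subset of $\mathbb{R}^{d_n}$. $\mathcal{S}^{d-1}$ is the unit sphere in $\mathbb{R}^d$. $\varphi_{X_n}(u)=\mathbb{E}\exp(\mathrm{i}u'X_n)$ is the characteristic function of $X_n$. $A_{n,k}=\big(\widetilde X_{n,j}'\widetilde X_{n,r}\big)_{j,r=1}^k$ is the $k\times k$ Gram matrix of mutually independent copies $\widetilde X_{n,1},\ldots,\widetilde X_{n,k}$ of $X_n$. $F_{Y_n|\Xi_n}(y)=\mathbb{P}(Y_n\le y\mid\Xi_n)$ is the conditional cumulative distribution function of $Y_n$ given $\Xi_n$; $F_{\mathcal{N}_1(0,\sigma^2)}$ is the cumulative distribution function of the normal distribution with mean $0$ and variance $\sigma^2$; $\mathbb{E}_{\Xi_n}$ denotes expectation with respect to the distribution of $\Xi_n$. *)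

theory Defs
  imports "HOL-Probability.Probability" "Jordan_Normal_Form.Determinant"
begin

text \<open>
  The vectors of \<open>\<real>\<^sup>d\<close> are functions \<open>nat \<Rightarrow> real\<close> with index set \<open>{..<d}\<close>, equal to
  \<open>undefined\<close> off that set. This is the carrier of both the library's product measure and
  the library's product topology. The Euclidean norm is \<open>L2_set x {..<d}\<close>.
\<close>

abbreviation lborel_R :: "nat \<Rightarrow> (nat \<Rightarrow> real) measure" where
  "lborel_R d \<equiv> PiM {..<d} (\<lambda>_. lborel)"

abbreviation top_R :: "nat \<Rightarrow> (nat \<Rightarrow> real) topology" where
  "top_R d \<equiv> product_topology (\<lambda>_. euclideanreal) {..<d}"

definition dot :: "nat \<Rightarrow> (nat \<Rightarrow> real) \<Rightarrow> (nat \<Rightarrow> real) \<Rightarrow> real" where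
  "dot d x y = (\<Sum>i<d. x i * y i)"

text \<open>
  The density vanishes off an open set \<open>U\<close> and is continuous on \<open>U\<close>; a jump at the boundary
  of \<open>U\<close> is allowed (as for the uniform distribution on a ball), and \<open>U\<close> may be all of
  \<open>\<real>\<^sup>d\<close>.
\<close>

definition continuous_random_vector ::
    "'a measure \<Rightarrow> nat \<Rightarrow> ('a \<Rightarrow> nat \<Rightarrow> real) \<Rightarrow> bool" where
  "continuous_random_vector M d X \<longleftrightarrow>
     (\<exists>f U. openin (top_R d) U
        \<and> continuous_map (subtopology (top_R d) U) euclideanreal f
        \<and> (\<forall>x\<in>topspace (top_R d). 0 \<le> f x)
        \<and> (\<forall>x\<in>topspace (top_R d) - U. f x = 0)
        \<and> distributed M (lborel_R d) X (\<lambda>x. ennreal (f x)))"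

text \<open>
  Convergence in probability to a constant; the \<open>n\<close>-th variable may live on its own
  probability space \<open>P n\<close>.
\<close>

definition tendsto_in_prob ::
    "(nat \<Rightarrow> 'b measure) \<Rightarrow> (nat \<Rightarrow> 'b \<Rightarrow> real) \<Rightarrow> real \<Rightarrow> bool" where
  "tendsto_in_prob P Z c \<longleftrightarrow>
     (\<forall>\<epsilon>>0. (\<lambda>n. measure (P n) {\<omega>\<in>space (P n). \<bar>Z n \<omega> - c\<bar> > \<epsilon>}) \<longlonglongrightarrow> 0)"

text \<open>
  The Gram matrix of \<open>k\<close> mutually independent copies of \<open>X\<close>, as a function on the product
  probability space \<open>PiM {..<k} (\<lambda>_. M)\<close>, on which the \<open>j\<close>-th copy is \<open>\<lambda>\<omega>. X (\<omega> j)\<close>.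
\<close>

definition gram :: "nat \<Rightarrow> nat \<Rightarrow> ('a \<Rightarrow> nat \<Rightarrow> real) \<Rightarrow> (nat \<Rightarrow> 'a) \<Rightarrow> real mat" where
  "gram d k X \<omega> = Matrix.mat k k (\<lambda>(j, r). dot d (X (\<omega> j)) (X (\<omega> r)))"

definition char_vec ::
    "'a measure \<Rightarrow> nat \<Rightarrow> ('a \<Rightarrow> nat \<Rightarrow> real) \<Rightarrow> (nat \<Rightarrow> real) \<Rightarrow> complex" where
  "char_vec M d X u = (CLINT \<omega>|M. iexp (dot d u (X \<omega>)))"

definition unit_sphere :: "nat \<Rightarrow> (nat \<Rightarrow> real) set" where
  "unit_sphere d = {x \<in> space (lborel_R d). L2_set x {..<d} = 1}"

text \<open>
  Surface measure by polar coordinates: the set \<open>B\<close> has measure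
  \<open>d \<cdot> \<lambda> {x. 0 < \<parallel>x\<parallel> \<le> 1 \<and> x / \<parallel>x\<parallel> \<in> B}\<close>. For \<open>d = 1\<close> this is
  counting measure on the two points of the sphere.
\<close>

definition surface_measure :: "nat \<Rightarrow> (nat \<Rightarrow> real) measure" where
  "surface_measure d = scale_measure (of_nat d)
     (distr (restrict_space (lborel_R d)
               {x \<in> space (lborel_R d). 0 < L2_set x {..<d} \<and> L2_set x {..<d} \<le> 1})
        (restrict_space (lborel_R d) (unit_sphere d))
        (\<lambda>x. \<lambda>i\<in>{..<d}. x i / L2_set x {..<d}))"

definition std_normal_R :: "nat \<Rightarrow> (nat \<Rightarrow> real) measure" where
  "std_normal_R d = PiM {..<d} (\<lambda>_. std_normal_distribution)"

text \<open>
  \<open>\<P>(Y \<le> y | \<Xi>)\<close> as a random variable: the conditional expectation of the indicator of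
  \<open>{Y \<le> y}\<close> given the \<open>\<sigma>\<close>-algebra generated by \<open>\<Xi>\<close>. It is determined up to null sets.
\<close>

definition cond_cdf ::
    "'a measure \<Rightarrow> 'b measure \<Rightarrow> ('a \<Rightarrow> 'b) \<Rightarrow> ('a \<Rightarrow> real) \<Rightarrow> real \<Rightarrow> 'a \<Rightarrow> real" where
  "cond_cdf M N \<Xi> Y y =
     real_cond_exp M (vimage_algebra (space M) \<Xi> N) (indicator {\<omega>\<in>space M. Y \<omega> \<le> y})"

end

theory Submission
  imports Defs
begin

text \<open>
  Distribution functions lie in \<open>[0, 1]\<close>, so the \<open>p\<close>-th moments converge as soon as the random
  distribution functions converge in probability, uniformly in \<open>y\<close>. By independence the
  conditional law of \<open>Y\<close> given \<open>\<Xi> = \<xi>\<close> is the law of \<open>\<xi> \<cdot> X\<close>. With an independent copy \<open>X'\<close> of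
  \<open>X\<close>, Fubini and the Gaussian characteristic function show that the mean square distance over
  \<open>\<xi>\<close> between its characteristic function at \<open>t\<close> and a real number \<open>c\<close> is
  \<open>E exp (-t\<^sup>2 \<parallel>X - X'\<parallel>\<^sup>2 / 2) - 2 c E exp (-t\<^sup>2 \<parallel>X\<parallel>\<^sup>2 / 2) + c\<^sup>2\<close>, which tends to \<open>0\<close> for
  \<open>c = exp (-\<sigma>\<^sup>2 t\<^sup>2 / 2)\<close> because \<open>\<parallel>X\<parallel>\<^sup>2\<close> tends to \<open>\<sigma>\<^sup>2\<close> and \<open>X \<cdot> X'\<close> to \<open>0\<close>. A Gaussian smoothing
  inequality turns this into closeness of the distribution functions, uniformly in \<open>y\<close>.
\<close>

subsection \<open>Smoothing\<close>

text \<open>Subtract the two Levy inversion formulas, which are available because the endpoints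
  carry no mass. The inversion kernel is bounded by \<open>b - a\<close>, so the truncated integrals
  of the difference are bounded independently of the truncation \<open>T\<close>, and the bound
  passes to the limit.\<close>

lemma measure_Ioc_diff_le_char:
  assumes "real_distribution M1" "real_distribution M2" "a \<le> b"
    and "measure M1 {a} = 0" "measure M1 {b} = 0" "measure M2 {a} = 0" "measure M2 {b} = 0"
    and int: "integrable lborel (\<lambda>t. char M1 t - char M2 t)"
  shows "\<bar>measure M1 {a<..b} - measure M2 {a<..b}\<bar>
           \<le> (b - a) / (2 * pi) * (\<integral>t. cmod (char M1 t - char M2 t) \<partial>lborel)"
proof -
  interpret M1: real_distribution M1 by fact
  interpret M2: real_distribution M2 by fact
  \<comment> \<open>The kernel of Levy inversion: for \<open>t\<close> other than 0 it is the
    integral of \<open>iexp (-(t * x))\<close> over \<open>x\<close> from \<open>a\<close> to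
    \<open>b\<close>, whence the bound \<open>b - a\<close>. At 0 the division yields the value 0,
    which satisfies the same bound.\<close>
  define F where "F = (\<lambda>t::real. (iexp (-(t * a)) - iexp (-(t * b))) / (\<i> * t))"
  have F[measurable]: "F \<in> borel_measurable borel"
    unfolding F_def by measurable
  have F_le: "cmod (F t) \<le> b - a" for t
  proof (cases "t = 0")
    case False
    then show ?thesis
      using Levy_Inversion_aux2[of "-b" "-a" t] \<open>a \<le> b\<close> by (simp add: F_def)
  qed (use \<open>a \<le> b\<close> in \<open>simp add: F_def\<close>)
  \<comment> \<open>On a bounded interval the bounded integrand is integrable for each law
    separately; this allows the two truncated integrals to be merged into one.\<close>
  have ii: "interval_lebesgue_integrable lborel (ereal (-T)) (ereal T) (\<lambda>t. F t * char N t)"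
    if "real_distribution N" for N and T :: real
  proof -
    interpret N: real_distribution N by fact
    have "cmod (F t * char N t) \<le> (b - a) * 1" for t
      unfolding norm_mult by (intro mult_mono F_le N.cmod_char_le_1) (use \<open>a \<le> b\<close> in auto)
    then show ?thesis
      unfolding interval_lebesgue_integrable_def set_integrable_def
      by (auto intro!: integrableI_bounded_set_indicator[where B="(b - a) * 1"])
  qed
  have "(\<lambda>T::nat. 1 / (2 * pi) * (CLBINT t=-real T..real T. F t * char M1 t)
      - 1 / (2 * pi) * (CLBINT t=-real T..real T. F t * char M2 t))
    \<longlonglongrightarrow> complex_of_real (measure M1 {a<..b}) - complex_of_real (measure M2 {a<..b})"
    unfolding F_def using assms
    by (intro tendsto_diff M1.Levy_Inversion[unfolded of_int_minus of_int_of_nat_eq]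
        M2.Levy_Inversion[unfolded of_int_minus of_int_of_nat_eq])
  then have "(\<lambda>T. cmod (1 / (2 * pi) * (CLBINT t=-real T..real T. F t * char M1 t)
      - 1 / (2 * pi) * (CLBINT t=-real T..real T. F t * char M2 t)))
    \<longlonglongrightarrow> cmod (complex_of_real (measure M1 {a<..b}) - complex_of_real (measure M2 {a<..b}))"
    by (rule tendsto_norm)
  moreover have "cmod (1 / (2 * pi) * (CLBINT t=-real T..real T. F t * char M1 t)
      - 1 / (2 * pi) * (CLBINT t=-real T..real T. F t * char M2 t))
      \<le> (b - a) / (2 * pi) * (\<integral>t. cmod (char M1 t - char M2 t) \<partial>lborel)" for T
  proof -
    let ?I = "einterval (ereal (- real T)) (ereal (real T))"
    have "1 / (2 * pi) * (CLBINT t=-real T..real T. F t * char M1 t)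
      - 1 / (2 * pi) * (CLBINT t=-real T..real T. F t * char M2 t)
      = 1 / (2 * pi) * ((CLBINT t=-real T..real T. F t * char M1 t)
          - (CLBINT t=-real T..real T. F t * char M2 t))"
      by (simp add: algebra_simps)
    also have "\<dots> = 1 / (2 * pi) * (CLBINT t=-real T..real T. F t * char M1 t - F t * char M2 t)"
      using ii[OF assms(1), of T] ii[OF assms(2), of T]
      by (subst interval_lebesgue_integral_diff(2)) auto
    also have "\<dots> = 1 / (2 * pi) * (CLINT t|lborel. indicator ?I t *\<^sub>R (F t * (char M1 t - char M2 t)))"
      by (simp add: interval_lebesgue_integral_def set_lebesgue_integral_def right_diff_distrib)
    finally have "cmod (1 / (2 * pi) * (CLBINT t=-real T..real T. F t * char M1 t)
      - 1 / (2 * pi) * (CLBINT t=-real T..real T. F t * char M2 t))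
      = 1 / (2 * pi) * cmod (CLINT t|lborel. indicator ?I t *\<^sub>R (F t * (char M1 t - char M2 t)))"
      by (simp add: norm_mult norm_divide)
    also have "\<dots> \<le> 1 / (2 * pi) * (\<integral>t. (b - a) * cmod (char M1 t - char M2 t) \<partial>lborel)"
    proof (intro mult_left_mono Bochner_Integration.integral_norm_bound_integral)
      have le: "cmod (indicator ?I t *\<^sub>R (F t * (char M1 t - char M2 t)))
          \<le> (b - a) * cmod (char M1 t - char M2 t)" for t
        using F_le[of t] by (auto simp: norm_mult indicator_def intro!: mult_right_mono)
                            (use \<open>a \<le> b\<close> in auto)
      show "integrable lborel (\<lambda>t. (b - a) * cmod (char M1 t - char M2 t))"
        using int by auto
      then show "integrable lborel (\<lambda>t. indicator ?I t *\<^sub>R (F t * (char M1 t - char M2 t)))"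
        by (rule Bochner_Integration.integrable_bound) (use le \<open>a \<le> b\<close> in \<open>auto simp: abs_mult\<close>)
      show "cmod (indicator ?I t *\<^sub>R (F t * (char M1 t - char M2 t)))
          \<le> (b - a) * cmod (char M1 t - char M2 t)" for t
        by (rule le)
    qed auto
    also have "\<dots> = (b - a) / (2 * pi) * (\<integral>t. cmod (char M1 t - char M2 t) \<partial>lborel)"
      by simp
    finally show ?thesis .
  qed
  ultimately have "cmod (complex_of_real (measure M1 {a<..b}) - complex_of_real (measure M2 {a<..b}))
     \<le> (b - a) / (2 * pi) * (\<integral>t. cmod (char M1 t - char M2 t) \<partial>lborel)"
    by (intro LIMSEQ_le_const2) auto
  then show ?thesis
    by (metis norm_of_real of_real_diff)
qed

section \<open>Convolution with Gaussian noise\<close>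

text \<open>The convolution of \<open>M\<close> with the centred normal law of standard deviation
  \<open>\<bar>\<epsilon>\<bar>\<close>, encoded as the image of a product measure so that Fubini
  and set inclusions on the product apply directly.\<close>

definition gauss_smooth :: "real \<Rightarrow> real measure \<Rightarrow> real measure" where
  "gauss_smooth \<epsilon> M = distr (M \<Otimes>\<^sub>M std_normal_distribution) borel (\<lambda>(x, z). x + \<epsilon> * z)"

interpretation std_normal: real_distribution std_normal_distribution
  by (rule real_dist_normal_dist)

lemma emeasure_std_normal_singleton: "emeasure std_normal_distribution {x} = 0"
  by (subst emeasure_density) (auto intro!: nn_integral_null_set)

context
  fixes M :: "real measure"
  assumes M: "real_distribution M"
begin

interpretation M: real_distribution M by (rule M)

interpretation P: pair_prob_space M std_normal_distribution ..

lemma sets_pair_std_normal[measurable_cong]: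
  "sets (M \<Otimes>\<^sub>M std_normal_distribution) = sets (borel \<Otimes>\<^sub>M borel)"
  by (intro sets_pair_measure_cong) simp_all

lemma real_distribution_gauss_smooth: "real_distribution (gauss_smooth \<epsilon> M)"
  unfolding gauss_smooth_def by (intro prob_space.real_distribution_distr[OF P.prob_space_axioms]) measurable

text \<open>Independence of the noise splits the integral into a product. The Gaussian factor makes
  differences of smoothed characteristic functions integrable, as the inversion bound
  requires.\<close>

lemma char_gauss_smooth: "char (gauss_smooth \<epsilon> M) t = char M t * exp (- (\<epsilon> * t)\<^sup>2 / 2)"
proof -
  have "char (gauss_smooth \<epsilon> M) t = (CLINT p|M \<Otimes>\<^sub>M std_normal_distribution. iexp (t * (fst p + \<epsilon> * snd p)))"
    unfolding gauss_smooth_def char_def by (subst integral_distr) (auto simp: case_prod_beta')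
  also have "\<dots> = (CLINT x|M. CLINT z|std_normal_distribution. iexp (t * (x + \<epsilon> * z)))"
    by (subst P.integral_fst'[symmetric]) (auto intro!: P.integrable_const_bound[where B=1])
  also have "\<dots> = (CLINT x|M. CLINT z|std_normal_distribution. iexp (t * x) * iexp ((\<epsilon> * t) * z))"
    by (intro Bochner_Integration.integral_cong refl) (simp add: algebra_simps flip: exp_add)
  also have "\<dots> = char M t * char std_normal_distribution (\<epsilon> * t)"
    unfolding char_def by simp
  finally show ?thesis by (simp add: char_std_normal_distribution)
qed

text \<open>For each fixed \<open>x\<close> a single value of the noise leads to \<open>a\<close>,
  and single values are null for the normal law.\<close>

lemma gauss_smooth_no_atoms:
  assumes "\<epsilon> \<noteq> 0" shows "measure (gauss_smooth \<epsilon> M) {a} = 0"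
proof -
  have "emeasure (gauss_smooth \<epsilon> M) {a} = (\<integral>\<^sup>+p. indicator {a} (fst p + \<epsilon> * snd p) \<partial>(M \<Otimes>\<^sub>M std_normal_distribution))"
    unfolding gauss_smooth_def
    by (subst nn_integral_indicator[symmetric], simp, subst nn_integral_distr) (auto simp: case_prod_beta')
  also have "\<dots> = (\<integral>\<^sup>+x. \<integral>\<^sup>+z. indicator {a} (x + \<epsilon> * z) \<partial>std_normal_distribution \<partial>M)"
    by (subst std_normal.nn_integral_fst[symmetric]) auto
  also have "\<dots> = (\<integral>\<^sup>+x. \<integral>\<^sup>+z. indicator {(a - x) / \<epsilon>} z \<partial>std_normal_distribution \<partial>M)"
    using assms by (intro nn_integral_cong) (auto simp: indicator_def field_simps)
  also have "\<dots> = 0"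
    by (subst nn_integral_indicator) (auto simp: emeasure_std_normal_singleton)
  finally show ?thesis by (simp add: measure_def)
qed

text \<open>Unless the noise exceeds \<delta>, adding it moves a point by at most \<delta>; hence
  the two events are nested up to a shift by \<delta> and the tail event of the noise.\<close>

lemma cdf_gauss_smooth_bounds:
  assumes "\<epsilon> > 0"
  shows "cdf M y \<le> cdf (gauss_smooth \<epsilon> M) (y + \<delta>) + measure std_normal_distribution {z. \<delta> < \<epsilon> * \<bar>z\<bar>}"
    and "cdf (gauss_smooth \<epsilon> M) y \<le> cdf M (y + \<delta>) + measure std_normal_distribution {z. \<delta> < \<epsilon> * \<bar>z\<bar>}"
proof -
  let ?P = "M \<Otimes>\<^sub>M std_normal_distribution"
  have S: "cdf (gauss_smooth \<epsilon> M) y = measure ?P {p. fst p + \<epsilon> * snd p \<le> y}" for y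
    unfolding cdf_def gauss_smooth_def
    by (subst measure_distr) (auto simp: space_pair_measure intro!: arg_cong[where f="measure _"])
  have N: "measure std_normal_distribution {z. \<delta> < \<epsilon> * \<bar>z\<bar>} = measure ?P (UNIV \<times> {z. \<delta> < \<epsilon> * \<bar>z\<bar>})"
    using M.emeasure_space_1 by (simp add: measure_def std_normal.emeasure_pair_measure_Times)
  have C: "cdf M y = measure ?P ({..y} \<times> UNIV)" for y
    using std_normal.emeasure_space_1 by (simp add: cdf_def measure_def std_normal.emeasure_pair_measure_Times)
  have sets: "{p. fst p + \<epsilon> * snd p \<le> y} \<in> sets ?P" "UNIV \<times> {z. \<delta> < \<epsilon> * \<bar>z\<bar>} \<in> sets ?P"
      "{..y} \<times> UNIV \<in> sets ?P" for y
    using measurable_sets[of "\<lambda>p. fst p + \<epsilon> * snd p" "borel \<Otimes>\<^sub>M borel" borel "{..y}"]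
    by (simp_all add: sets_pair_std_normal space_pair_measure vimage_def pair_measureI)
  have le: "\<epsilon> * z \<le> \<epsilon> * \<bar>z\<bar>" "- (\<epsilon> * z) \<le> \<epsilon> * \<bar>z\<bar>" for z
    using assms mult_left_mono[of z "\<bar>z\<bar>" \<epsilon>] mult_left_mono[of "-z" "\<bar>z\<bar>" \<epsilon>] by auto
  show "cdf M y \<le> cdf (gauss_smooth \<epsilon> M) (y + \<delta>) + measure std_normal_distribution {z. \<delta> < \<epsilon> * \<bar>z\<bar>}"
    unfolding S N C
  proof (rule order_trans[OF P.finite_measure_mono measure_Un_le])
    show "{..y} \<times> UNIV \<subseteq> {p. fst p + \<epsilon> * snd p \<le> y + \<delta>} \<union> UNIV \<times> {z. \<delta> < \<epsilon> * \<bar>z\<bar>}"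
      using le(1) by clarsimp (smt (verit))
  qed (use sets in blast)+
  show "cdf (gauss_smooth \<epsilon> M) y \<le> cdf M (y + \<delta>) + measure std_normal_distribution {z. \<delta> < \<epsilon> * \<bar>z\<bar>}"
    unfolding S N C
  proof (rule order_trans[OF P.finite_measure_mono measure_Un_le])
    show "{p. fst p + \<epsilon> * snd p \<le> y} \<subseteq> {..y + \<delta>} \<times> UNIV \<union> UNIV \<times> {z. \<delta> < \<epsilon> * \<bar>z\<bar>}"
      using le(2) by clarsimp (smt (verit))
  qed (use sets in blast)+
qed

end

section \<open>From characteristic functions to distribution functions\<close>

lemma integrable_exp_minus_square:
  fixes \<epsilon> :: real
  assumes "\<epsilon> > 0"
  shows "integrable lborel (\<lambda>t. exp (- (\<epsilon> * t)\<^sup>2 / 2))"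
proof -
  have "integrable lborel (\<lambda>x. sqrt (2 * pi) * std_normal_density x)"
    using integrable_std_normal_moment[of 0] by simp
  then have "integrable lborel (\<lambda>x::real. exp (- x\<^sup>2 / 2))"
    by (simp add: std_normal_density_def)
  then show ?thesis
    using assms lborel_integrable_real_affine_iff[of \<epsilon> "\<lambda>x. exp (- x\<^sup>2 / 2)" 0] by simp
qed

lemma (in real_distribution) cdf_tails:
  assumes "e > 0"
  obtains K where "K > 0" "cdf M (- K) < e" "1 - cdf M K < e"
proof -
  have "eventually (\<lambda>K. cdf M K > 1 - e) at_top"
    using order_tendstoD(1)[OF cdf_lim_at_top_prob, of "1 - e"] assms by simp
  moreover have "eventually (\<lambda>K. cdf M (- K) < e) at_top"
    using order_tendstoD(2)[OF cdf_lim_at_bot assms] by (simp add: at_bot_mirror eventually_filtermap)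
  ultimately have "eventually (\<lambda>K. cdf M K > 1 - e \<and> cdf M (- K) < e \<and> K > 0) at_top"
    using eventually_gt_at_top[of 0] by eventually_elim auto
  then obtain K where "cdf M K > 1 - e" "cdf M (- K) < e" "K > 0"
    by (auto simp: eventually_at_top_linorder)
  then show ?thesis
    by (intro that[of K]) auto
qed

text \<open>A smoothing inequality of Esseen type; the Gaussian factor is the characteristic function
  of the noise that is added to both distributions.\<close>

lemma cdf_diff_le_char_diff:
  assumes N: "real_distribution N"
    and lip: "\<And>x y. x \<le> y \<Longrightarrow> cdf N y - cdf N x \<le> L * (y - x)"
    and "\<eta> > 0"
  obtains \<epsilon> C where "\<epsilon> > 0" "C \<ge> 0"
    "\<And>M y. real_distribution M \<Longrightarrow> \<bar>cdf M y - cdf N y\<bar> \<le> \<eta> + C *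
       (\<integral>t. cmod (char M t - char N t) * exp (- (\<epsilon> * t)\<^sup>2 / 2) \<partial>lborel)"
proof -
  interpret N: real_distribution N by fact
  \<comment> \<open>The error is spent as follows: \<open>2 * e\<close> for the noise added to
    \<open>M\<close>, \<open>2 * e\<close> for the noise added to \<open>N\<close>,
    \<open>2 * e\<close> for the tails of the smoothed laws and \<open>e\<close> for the modulus of
    continuity of \<open>N\<close>.\<close>
  define e where "e = \<eta> / 7"
  have "e > 0" using \<open>\<eta> > 0\<close> by (simp add: e_def)
  \<comment> \<open>Chosen so that \<open>cdf N\<close> grows by at most \<open>e\<close> over a
    distance \<open>2 * \<delta>\<close>; \<open>\<bar>L\<bar> + 1\<close> keeps the denominator
    positive whatever \<open>L\<close> is.\<close>
  define \<delta> where "\<delta> = e / (2 * (\<bar>L\<bar> + 1))"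
  have "\<delta> > 0" using \<open>e > 0\<close> by (simp add: \<delta>_def)
  have "L * (2 * \<delta>) \<le> (\<bar>L\<bar> + 1) * (2 * \<delta>)"
    using \<open>\<delta> > 0\<close> by (intro mult_right_mono) auto
  also have "\<dots> = e" by (simp add: \<delta>_def field_simps)
  finally have L: "L * (2 * \<delta>) \<le> e" .
  obtain K where K: "K > 0" "cdf std_normal_distribution (- K) < e" "1 - cdf std_normal_distribution K < e"
    using std_normal.cdf_tails[OF \<open>e > 0\<close>] .
  \<comment> \<open>With this scale the tail event of the noise is \<open>\<bar>z\<bar> > K\<close>,
    whose mass is below \<open>2 * e\<close> by the choice of \<open>K\<close>.\<close>
  define \<epsilon> where "\<epsilon> = \<delta> / K"
  have "\<epsilon> > 0" using \<open>\<delta> > 0\<close> K by (simp add: \<epsilon>_def)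
  have "measure std_normal_distribution {z. \<delta> < \<epsilon> * \<bar>z\<bar>}
    \<le> measure std_normal_distribution ({..- K} \<union> (UNIV - {..K}))"
    using K \<open>\<delta> > 0\<close> by (intro std_normal.finite_measure_mono) (auto simp: \<epsilon>_def field_simps abs_if split: if_splits)
  also have "\<dots> \<le> measure std_normal_distribution {..- K} + measure std_normal_distribution (UNIV - {..K})"
    by (intro measure_Un_le) auto
  also have "measure std_normal_distribution (UNIV - {..K}) = 1 - cdf std_normal_distribution K"
    using std_normal.prob_compl[of "{..K}"] by (simp add: cdf_def)
  also have "measure std_normal_distribution {..- K} = cdf std_normal_distribution (- K)"
    by (simp add: cdf_def)
  finally have noise: "measure std_normal_distribution {z. \<delta> < \<epsilon> * \<bar>z\<bar>} \<le> 2 * e"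
    using K by linarith
  interpret SN: real_distribution "gauss_smooth \<epsilon> N"
    by (rule real_distribution_gauss_smooth[OF N])
  \<comment> \<open>The inversion bound grows with the length of the interval, so it is applied only
    inside \<open>[-B, B]\<close>, where \<open>b - a \<le> 2 * B\<close> gives the constant
    \<open>B / pi\<close>. Since \<open>B\<close> comes from the smoothed \<open>N\<close> alone,
    this constant serves every \<open>M\<close>.\<close>
  obtain B where B: "B > 0" "cdf (gauss_smooth \<epsilon> N) (- B) < e" "1 - cdf (gauss_smooth \<epsilon> N) B < e"
    using SN.cdf_tails[OF \<open>e > 0\<close>] .
  have "\<bar>cdf M y - cdf N y\<bar> \<le> \<eta> + B / pi *
       (\<integral>t. cmod (char M t - char N t) * exp (- (\<epsilon> * t)\<^sup>2 / 2) \<partial>lborel)" (is "_ \<le> _ + _ * ?D")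
    if M: "real_distribution M" for M y
  proof -
    interpret M: real_distribution M by fact
    interpret SM: real_distribution "gauss_smooth \<epsilon> M"
      by (rule real_distribution_gauss_smooth[OF M])
    let ?F = "cdf (gauss_smooth \<epsilon> M)" and ?G = "cdf (gauss_smooth \<epsilon> N)"
    define H where "H = B / pi * ?D"
    have diff: "char (gauss_smooth \<epsilon> M) t - char (gauss_smooth \<epsilon> N) t
        = (char M t - char N t) * exp (- (\<epsilon> * t)\<^sup>2 / 2)" for t
      by (simp add: char_gauss_smooth[OF M] char_gauss_smooth[OF N] algebra_simps)
    have le2: "cmod (char M t - char N t) \<le> 2" for t
      using norm_triangle_ineq4[of "char M t" "char N t"] M.cmod_char_le_1[of t] N.cmod_char_le_1[of t]
      by linarith
    have int: "integrable lborel (\<lambda>t. char (gauss_smooth \<epsilon> M) t - char (gauss_smooth \<epsilon> N) t)"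
    proof (rule Bochner_Integration.integrable_bound)
      show "integrable lborel (\<lambda>t. 2 * exp (- (\<epsilon> * t)\<^sup>2 / 2))"
        using integrable_exp_minus_square[OF \<open>\<epsilon> > 0\<close>] by simp
      show "AE t in lborel. cmod (char (gauss_smooth \<epsilon> M) t - char (gauss_smooth \<epsilon> N) t)
        \<le> norm (2 * exp (- (\<epsilon> * t)\<^sup>2 / 2))"
        using le2 by (auto simp: diff norm_mult)
    qed auto
    have "0 \<le> H"
      unfolding H_def using B by (intro mult_nonneg_nonneg Bochner_Integration.integral_nonneg) auto
    have Ioc: "\<bar>(?F b - ?F a) - (?G b - ?G a)\<bar> \<le> H" if "- B \<le> a" "a \<le> b" "b \<le> B" for a b
    proof (cases "a = b")
      case False
      then have "\<bar>(?F b - ?F a) - (?G b - ?G a)\<bar>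
        = \<bar>measure (gauss_smooth \<epsilon> M) {a<..b} - measure (gauss_smooth \<epsilon> N) {a<..b}\<bar>"
        using that by (simp add: SM.cdf_diff_eq SN.cdf_diff_eq)
      also have "\<dots> \<le> (b - a) / (2 * pi) *
          (\<integral>t. cmod (char (gauss_smooth \<epsilon> M) t - char (gauss_smooth \<epsilon> N) t) \<partial>lborel)"
        using that \<open>\<epsilon> > 0\<close> int
        by (intro measure_Ioc_diff_le_char SM.real_distribution_axioms SN.real_distribution_axioms
                  gauss_smooth_no_atoms M N) auto
      also have "\<dots> = (b - a) / (2 * pi) * ?D"
        by (simp add: diff norm_mult)
      also have "\<dots> \<le> (2 * B) / (2 * pi) * ?D"
        using that by (intro mult_right_mono divide_right_mono Bochner_Integration.integral_nonneg) auto
      finally show ?thesis by (simp add: H_def)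
    qed (use \<open>0 \<le> H\<close> in simp)
    \<comment> \<open>Nothing is known beforehand about the tails of the smoothed \<open>M\<close>.
      Its mass between \<open>-B\<close> and \<open>B\<close> is within \<open>H\<close> of that of
      the smoothed \<open>N\<close>, hence at least \<open>1 - 2 * e - H\<close>, so each of its
      tails is at most \<open>2 * e + H\<close>. Inside the window, comparison on the part to the
      right of \<open>x\<close> bounds the difference from above and comparison on the part to the
      left bounds it from below.\<close>
    have FG: "\<bar>?F x - ?G x\<bar> \<le> 2 * e + H" for x
    proof -
      have b: "0 \<le> ?F x" "?F x \<le> 1" "0 \<le> ?G x" "?G x \<le> 1" "0 \<le> ?F (- B)" "?F B \<le> 1" "?G B \<le> 1" "0 \<le> ?G (- B)"
        using SM.cdf_nonneg SN.cdf_nonneg SM.cdf_bounded_prob SN.cdf_bounded_prob by auto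
      consider "x < - B" | "- B \<le> x" "x \<le> B" | "x > B" by linarith
      then show ?thesis
      proof cases
        case 1
        then have "?F x \<le> ?F (- B)" by (intro SM.cdf_nondecreasing) auto
        moreover have "?G x \<le> ?G (- B)" using 1 by (intro SN.cdf_nondecreasing) auto
        ultimately show ?thesis using Ioc[of "- B" B] b B \<open>0 \<le> H\<close> by linarith
      next
        case 2
        then show ?thesis using Ioc[of x B] Ioc[of "- B" x] b B \<open>0 \<le> H\<close> by linarith
      next
        case 3
        then have "?F B \<le> ?F x" by (intro SM.cdf_nondecreasing) auto
        moreover have "?G B \<le> ?G x" using 3 by (intro SN.cdf_nondecreasing) auto
        ultimately show ?thesis using Ioc[of "- B" B] b B \<open>0 \<le> H\<close> by linarith
      qed
    qed
    \<comment> \<open>Passing from \<open>M\<close> to its smoothing costs one shift by \<delta>,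
      and passing back from the smoothing of \<open>N\<close> costs another; this is why
      \<open>N\<close> is compared at distance \<open>2 * \<delta>\<close>.\<close>
    have "cdf N (y + 2 * \<delta>) - cdf N y \<le> e" "cdf N y - cdf N (y - 2 * \<delta>) \<le> e"
      using lip[of y "y + 2 * \<delta>"] lip[of "y - 2 * \<delta>" y] L \<open>\<delta> > 0\<close> by auto
    moreover have "cdf M y \<le> ?F (y + \<delta>) + 2 * e" "?F (y - \<delta>) \<le> cdf M y + 2 * e"
      using cdf_gauss_smooth_bounds(1)[OF M \<open>\<epsilon> > 0\<close>, of y \<delta>]
        cdf_gauss_smooth_bounds(2)[OF M \<open>\<epsilon> > 0\<close>, of "y - \<delta>" \<delta>] noise by auto
    moreover have "?G (y + \<delta>) \<le> cdf N (y + 2 * \<delta>) + 2 * e" "cdf N (y - 2 * \<delta>) \<le> ?G (y - \<delta>) + 2 * e"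
      using cdf_gauss_smooth_bounds(1)[OF N \<open>\<epsilon> > 0\<close>, of "y - 2 * \<delta>" \<delta>]
        cdf_gauss_smooth_bounds(2)[OF N \<open>\<epsilon> > 0\<close>, of "y + \<delta>" \<delta>] noise by (auto simp: ac_simps)
    ultimately have "\<bar>cdf M y - cdf N y\<bar> \<le> 7 * e + H"
      using FG[of "y + \<delta>"] FG[of "y - \<delta>"] by linarith
    then show ?thesis by (simp add: e_def H_def)
  qed
  then show thesis
    using \<open>\<epsilon> > 0\<close> B by (intro that[of \<epsilon> "B / pi"]) auto
qed

subsection \<open>Gaussian projections of a random vector\<close>

lemma borel_measurable_dot[measurable]:
  assumes "f \<in> measurable M (lborel_R d)" "g \<in> measurable M (lborel_R d)"
  shows "(\<lambda>\<omega>. dot d (f \<omega>) (g \<omega>)) \<in> borel_measurable M"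
proof -
  have "(\<lambda>\<omega>. h \<omega> i) \<in> borel_measurable M" if "h \<in> measurable M (lborel_R d)" "i < d" for h i
    using measurable_compose[OF that(1) measurable_component_singleton[of i]] that(2) by simp
  with assms show ?thesis
    unfolding dot_def by (intro borel_measurable_sum borel_measurable_times) auto
qed

text \<open>Here \<xi> may be any function, also one outside the space of \<open>lborel_R d\<close>;
  for such \<xi> the constant map is not measurable into \<open>lborel_R d\<close>, so the preceding
  rule does not cover this case.\<close>

lemma borel_measurable_dot_const[measurable]:
  assumes "g \<in> measurable M (lborel_R d)"
  shows "(\<lambda>\<omega>. dot d \<xi> (g \<omega>)) \<in> borel_measurable M"
proof -
  have "(\<lambda>\<omega>. g \<omega> i) \<in> borel_measurable M" if "i < d" for i
    using measurable_compose[OF assms measurable_component_singleton[of i]] that by simp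
  then show ?thesis
    unfolding dot_def by (intro borel_measurable_sum borel_measurable_times) auto
qed

lemma dot_self: "dot d x x = (L2_set x {..<d})\<^sup>2"
  by (simp add: dot_def L2_set_def sum_nonneg power2_eq_square)

lemma dot_nonneg: "0 \<le> dot d x x"
  by (simp add: dot_self)

lemma dot_diff_self:
  "dot d (\<lambda>i. x i - y i) (\<lambda>i. x i - y i) = dot d x x + dot d y y - 2 * dot d x y"
  by (simp add: dot_def sum_distrib_left algebra_simps flip: sum.distrib sum_subtractf)

lemma dot_scale_right: "dot d x (\<lambda>i. t * y i) = t * dot d x y"
  by (simp add: dot_def sum_distrib_left algebra_simps)

lemma dot_scale_left: "dot d (\<lambda>i. t * x i) y = t * dot d x y"
  by (simp add: dot_def sum_distrib_left algebra_simps)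

lemma dot_diff_right: "dot d x (\<lambda>i. y i - z i) = dot d x y - dot d x z"
  by (simp add: dot_def algebra_simps flip: sum_subtractf)

section \<open>Standard Gaussian vectors\<close>

lemma prob_space_std_normal_R: "prob_space (std_normal_R d)"
  unfolding std_normal_R_def by (intro prob_space_PiM std_normal.prob_space_axioms)

lemma sets_std_normal_R[measurable_cong]: "sets (std_normal_R d) = sets (lborel_R d)"
  unfolding std_normal_R_def by (intro sets_PiM_cong) auto

text \<open>The exponential of the sum is a product over the coordinates, so the integral over the
  product measure factors into one-dimensional normal characteristic functions.\<close>

lemma integral_iexp_std_normal_R:
  "(CLINT \<xi>|std_normal_R d. iexp (dot d \<xi> x)) = exp (- (dot d x x) / 2)"
proof -
  interpret product_sigma_finite "\<lambda>_::nat. std_normal_distribution"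
    by (intro product_sigma_finite.intro std_normal.sigma_finite_measure_axioms)
  have "(CLINT \<xi>|std_normal_R d. iexp (dot d \<xi> x))
      = (CLINT \<xi>|PiM {..<d} (\<lambda>_. std_normal_distribution). \<Prod>i<d. iexp (x i * \<xi> i))"
    unfolding std_normal_R_def dot_def
    by (simp add: sum_distrib_left mult.commute flip: exp_sum)
  also have "\<dots> = (\<Prod>i<d. CLINT z|std_normal_distribution. iexp (x i * z))"
    by (intro product_integral_prod) (auto intro!: std_normal.integrable_iexp)
  also have "\<dots> = (\<Prod>i<d. complex_of_real (exp (- (x i)\<^sup>2 / 2)))"
    using char_std_normal_distribution by (simp add: char_def fun_eq_iff)
  also have "\<dots> = exp (- (dot d x x) / 2)"
    by (simp add: dot_def power2_eq_square sum_divide_distrib sum_negf flip: exp_sum of_real_prod)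
  finally show ?thesis .
qed

lemma integral_iexp_scale_std_normal_R:
  "(CLINT \<xi>|std_normal_R d. iexp (t * dot d \<xi> x)) = exp (- (t\<^sup>2 / 2 * dot d x x))"
proof -
  have "(CLINT \<xi>|std_normal_R d. iexp (t * dot d \<xi> x))
      = (CLINT \<xi>|std_normal_R d. iexp (dot d \<xi> (\<lambda>i. t * x i)))"
    by (simp only: dot_scale_right)
  also have "\<dots> = exp (- (t\<^sup>2 / 2 * dot d x x))"
    by (subst integral_iexp_std_normal_R) (simp add: dot_scale_right dot_scale_left power2_eq_square)
  finally show ?thesis .
qed

section \<open>The law of a projection in a fixed direction\<close>

text \<open>The explicit version of the conditional law of the inner product of \<Xi> and
  \<open>X\<close> given that \<Xi> equals \<xi>, when \<Xi> and \<open>X\<close> are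
  independent.\<close>

definition cond_law :: "'a measure \<Rightarrow> nat \<Rightarrow> ('a \<Rightarrow> nat \<Rightarrow> real) \<Rightarrow> (nat \<Rightarrow> real) \<Rightarrow> real measure" where
  "cond_law M d X \<xi> = distr M borel (\<lambda>\<omega>. dot d \<xi> (X \<omega>))"

context
  fixes M :: "'a measure" and d :: nat and X :: "'a \<Rightarrow> nat \<Rightarrow> real"
  assumes prob_M: "prob_space M" and X[measurable]: "X \<in> measurable M (lborel_R d)"
begin

interpretation M: prob_space M by (rule prob_M)
interpretation MM: pair_prob_space M M ..
interpretation G: prob_space "std_normal_R d" by (rule prob_space_std_normal_R)
interpretation GM: pair_prob_space "std_normal_R d" M ..
interpretation GMM: pair_prob_space "std_normal_R d" "M \<Otimes>\<^sub>M M" ..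

lemma real_distribution_cond_law: "real_distribution (cond_law M d X \<xi>)"
  unfolding cond_law_def by (intro M.real_distribution_distr) measurable

lemma char_cond_law: "char (cond_law M d X \<xi>) t = (CLINT \<omega>|M. iexp (t * dot d \<xi> (X \<omega>)))"
  unfolding cond_law_def char_def by (subst integral_distr) auto

lemma char_cond_law_measurable[measurable]:
  "(\<lambda>p. char (cond_law M d X (fst p)) (snd p)) \<in> borel_measurable (std_normal_R d \<Otimes>\<^sub>M lborel)"
  unfolding char_cond_law by measurable

lemma char_cond_law_measurable'[measurable]:
  "(\<lambda>\<xi>. char (cond_law M d X \<xi>) t) \<in> borel_measurable (std_normal_R d)"
  unfolding char_cond_law by measurable

lemma cmod_char_cond_law: "cmod (char (cond_law M d X \<xi>) t) \<le> 1"
  by (rule real_distribution.cmod_char_le_1[OF real_distribution_cond_law])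

text \<open>By Fubini the average over \<xi> may be taken first, with the vector
  \<open>X \<omega>\<close> fixed; there it is a Gaussian characteristic function.\<close>

lemma integral_char_cond_law:
  "(CLINT \<xi>|std_normal_R d. char (cond_law M d X \<xi>) t)
     = (\<integral>\<omega>. exp (- (t\<^sup>2 / 2 * dot d (X \<omega>) (X \<omega>))) \<partial>M)"
proof -
  have "(CLINT \<xi>|std_normal_R d. char (cond_law M d X \<xi>) t)
      = (CLINT \<omega>|M. CLINT \<xi>|std_normal_R d. iexp (t * dot d \<xi> (X \<omega>)))"
    unfolding char_cond_law
    by (rule GM.Fubini_integral[symmetric]) (auto intro!: GM.P.integrable_const_bound[where B=1] simp: case_prod_beta')
  also have "\<dots> = (CLINT \<omega>|M. complex_of_real (exp (- (t\<^sup>2 / 2 * dot d (X \<omega>) (X \<omega>)))))"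
    by (intro Bochner_Integration.integral_cong refl)
       (rule integral_iexp_scale_std_normal_R)
  finally show ?thesis by simp
qed

text \<open>The squared modulus of a characteristic function is that of the difference of two
  independent copies, here the two factors of \<open>M \<Otimes>\<^sub>M M\<close>. After Fubini the
  Gaussian average depends only on the squared distance of the copies.\<close>

lemma integral_norm_sq_char_cond_law:
  "(CLINT \<xi>|std_normal_R d. char (cond_law M d X \<xi>) t * cnj (char (cond_law M d X \<xi>) t))
     = (\<integral>(\<omega>, \<omega>'). exp (- (t\<^sup>2 / 2 * (dot d (X \<omega>) (X \<omega>) + dot d (X \<omega>') (X \<omega>') - 2 * dot d (X \<omega>) (X \<omega>')))) \<partial>(M \<Otimes>\<^sub>M M))"
proof -
  have "char (cond_law M d X \<xi>) t * cnj (char (cond_law M d X \<xi>) t)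
     = (CLINT p|M \<Otimes>\<^sub>M M. iexp (t * (dot d \<xi> (X (fst p)) - dot d \<xi> (X (snd p)))))" for \<xi>
  proof -
    have "char (cond_law M d X \<xi>) t * cnj (char (cond_law M d X \<xi>) t)
       = (CLINT \<omega>|M. iexp (t * dot d \<xi> (X \<omega>)) * (CLINT \<omega>'|M. iexp (- (t * dot d \<xi> (X \<omega>')))))"
    proof -
      have "cnj (CLINT \<omega>|M. iexp (t * dot d \<xi> (X \<omega>))) = (CLINT \<omega>|M. iexp (- (t * dot d \<xi> (X \<omega>))))"
        by (subst Bochner_Integration.integral_cnj[symmetric]) (simp add: exp_cnj)
      then show ?thesis unfolding char_cond_law by simp
    qed
    also have "\<dots> = (CLINT \<omega>|M. CLINT \<omega>'|M. iexp (t * (dot d \<xi> (X \<omega>) - dot d \<xi> (X \<omega>'))))"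
      by (simp add: algebra_simps exp_diff exp_minus divide_inverse flip: integral_mult_right_zero)
    also have "\<dots> = (CLINT p|M \<Otimes>\<^sub>M M. iexp (t * (dot d \<xi> (X (fst p)) - dot d \<xi> (X (snd p)))))"
      by (subst MM.integral_fst'[symmetric]) (auto intro!: MM.P.integrable_const_bound[where B=1])
    finally show ?thesis .
  qed
  then have "(CLINT \<xi>|std_normal_R d. char (cond_law M d X \<xi>) t * cnj (char (cond_law M d X \<xi>) t))
      = (CLINT \<xi>|std_normal_R d. CLINT p|M \<Otimes>\<^sub>M M. iexp (t * (dot d \<xi> (X (fst p)) - dot d \<xi> (X (snd p)))))"
    by simp
  also have "\<dots> = (CLINT p|M \<Otimes>\<^sub>M M. CLINT \<xi>|std_normal_R d. iexp (t * (dot d \<xi> (X (fst p)) - dot d \<xi> (X (snd p)))))"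
    by (rule GMM.Fubini_integral[symmetric]) (auto intro!: GMM.P.integrable_const_bound[where B=1] simp: case_prod_beta')
  also have "\<dots> = (CLINT p|M \<Otimes>\<^sub>M M. complex_of_real (exp (- (t\<^sup>2 / 2 *
      dot d (\<lambda>i. X (fst p) i - X (snd p) i) (\<lambda>i. X (fst p) i - X (snd p) i)))))"
    by (intro Bochner_Integration.integral_cong refl)
       (simp only: integral_iexp_scale_std_normal_R flip: dot_diff_right)
  finally show ?thesis by (simp add: dot_diff_self case_prod_beta')
qed

text \<open>Expand the squared modulus as a product with the conjugate. The two cross terms agree
  because \<open>c\<close> and the average of the characteristic function over \<xi> are both
  real.\<close>

lemma char_cond_law_L2:
  fixes c :: real
  shows "(\<integral>\<xi>. (cmod (char (cond_law M d X \<xi>) t - c))\<^sup>2 \<partial>std_normal_R d)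
     = (\<integral>(\<omega>, \<omega>'). exp (- (t\<^sup>2 / 2 * (dot d (X \<omega>) (X \<omega>) + dot d (X \<omega>') (X \<omega>') - 2 * dot d (X \<omega>) (X \<omega>')))) \<partial>(M \<Otimes>\<^sub>M M))
       - 2 * c * (\<integral>\<omega>. exp (- (t\<^sup>2 / 2 * dot d (X \<omega>) (X \<omega>))) \<partial>M) + c\<^sup>2" (is "?L = ?A - 2 * c * ?B + c\<^sup>2")
proof -
  let ?z = "\<lambda>\<xi>. char (cond_law M d X \<xi>) t"
  have z: "integrable (std_normal_R d) ?z"
    by (rule G.integrable_const_bound[where B=1]) (use cmod_char_cond_law in auto)
  have zz: "integrable (std_normal_R d) (\<lambda>\<xi>. ?z \<xi> * cnj (?z \<xi>))"
    using cmod_char_cond_law[of _ t]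
    by (intro G.integrable_const_bound[where B=1] borel_measurable_times char_cond_law_measurable'
          measurable_compose[OF char_cond_law_measurable' borel_measurable_continuous_onI[of cnj]])
       (auto simp: norm_mult intro!: mult_le_one continuous_intros)
  have "complex_of_real ?L = (CLINT \<xi>|std_normal_R d. (?z \<xi> - c) * cnj (?z \<xi> - c))"
    by (simp only: complex_norm_square flip: integral_complex_of_real)
  also have "\<dots> = (CLINT \<xi>|std_normal_R d. ?z \<xi> * cnj (?z \<xi>) - c * ?z \<xi> - c * cnj (?z \<xi>) + c\<^sup>2)"
    by (intro Bochner_Integration.integral_cong refl) (simp add: algebra_simps power2_eq_square)
  also have "\<dots> = (CLINT \<xi>|std_normal_R d. ?z \<xi> * cnj (?z \<xi>)) - c * (CLINT \<xi>|std_normal_R d. ?z \<xi>)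
      - c * cnj (CLINT \<xi>|std_normal_R d. ?z \<xi>) + c\<^sup>2"
    using z zz by (simp add: G.prob_space)
  also have "\<dots> = complex_of_real (?A - 2 * c * ?B + c\<^sup>2)"
    unfolding integral_char_cond_law integral_norm_sq_char_cond_law by simp
  finally show ?thesis by (simp only: of_real_eq_iff)
qed

end

subsection \<open>Convergence\<close>

text \<open>Split according to whether \<open>Z n\<close> is within \<open>e\<close> of
  \<open>c\<close>: nearby, continuity of \<open>g\<close> at the single point \<open>c\<close>
  makes the error small; elsewhere the error is at most 2 on an event of vanishing
  probability.\<close>

lemma tendsto_in_prob_integral:
  fixes g :: "real \<Rightarrow> real"
  assumes P: "\<And>n. n \<ge> 1 \<Longrightarrow> prob_space (P n)"
    and Z: "\<And>n. n \<ge> 1 \<Longrightarrow> Z n \<in> borel_measurable (P n)"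
    and lim: "tendsto_in_prob P Z c"
    and g: "isCont g c" "g \<in> borel_measurable borel" "\<And>x. \<bar>g x\<bar> \<le> 1"
  shows "(\<lambda>n. \<integral>\<omega>. g (Z n \<omega>) \<partial>P n) \<longlonglongrightarrow> g c"
proof (rule LIMSEQ_I)
  fix r :: real assume "r > 0"
  obtain e where "e > 0" and e: "\<And>x. \<bar>x - c\<bar> \<le> e \<Longrightarrow> \<bar>g x - g c\<bar> < r / 2"
  proof -
    obtain s where "s > 0" "\<And>x. dist x c < s \<Longrightarrow> dist (g x) (g c) < r / 2"
      using g(1) \<open>r > 0\<close> unfolding continuous_at_eps_delta by (meson half_gt_zero)
    then show thesis by (intro that[of "s / 2"]) (auto simp: dist_real_def)
  qed
  have "(\<lambda>n. measure (P n) {\<omega>\<in>space (P n). \<bar>Z n \<omega> - c\<bar> > e}) \<longlonglongrightarrow> 0"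
    using lim \<open>e > 0\<close> by (simp add: tendsto_in_prob_def)
  \<comment> \<open>An error of at most 2 on an event of probability below \<open>r / 4\<close>
    contributes less than \<open>r / 2\<close>; the other half of \<open>r\<close> is taken by
    continuity.\<close>
  then have "eventually (\<lambda>n. measure (P n) {\<omega>\<in>space (P n). \<bar>Z n \<omega> - c\<bar> > e} < r / 4) sequentially"
    by (rule order_tendstoD(2)) (use \<open>r > 0\<close> in simp)
  then have "eventually (\<lambda>n. norm ((\<integral>\<omega>. g (Z n \<omega>) \<partial>P n) - g c) < r) sequentially"
    using eventually_ge_at_top[of 1]
  proof eventually_elim
    case (elim n)
    interpret prob_space "P n" by (rule P) fact
    note [measurable] = Z[OF elim(2)] g(2)
    let ?S = "{\<omega>\<in>space (P n). \<bar>Z n \<omega> - c\<bar> > e}"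
    have int: "integrable (P n) (\<lambda>\<omega>. g (Z n \<omega>))"
      using g(3) by (intro integrable_const_bound[where B=1]) auto
    have intS: "integrable (P n) (\<lambda>\<omega>. r / 2 + 2 * indicator ?S \<omega>)"
      by (intro Bochner_Integration.integrable_add integrable_const integrable_mult_right integrable_real_indicator)
         (auto simp: emeasure_eq_measure)
    have "norm ((\<integral>\<omega>. g (Z n \<omega>) \<partial>P n) - g c) = norm (\<integral>\<omega>. g (Z n \<omega>) - g c \<partial>P n)"
      using int by (simp add: prob_space)
    also have "\<dots> \<le> (\<integral>\<omega>. r / 2 + 2 * indicator ?S \<omega> \<partial>P n)"
    proof (rule order_trans[OF Bochner_Integration.integral_norm_bound integral_mono])
      fix \<omega> assume "\<omega> \<in> space (P n)"
      show "norm (g (Z n \<omega>) - g c) \<le> r / 2 + 2 * indicator ?S \<omega>"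
      proof (cases "\<omega> \<in> ?S")
        case True
        then show ?thesis
          using g(3)[of "Z n \<omega>"] g(3)[of c] \<open>r > 0\<close> by (simp add: abs_le_iff)
      next
        case False
        then show ?thesis using e[of "Z n \<omega>"] \<open>\<omega> \<in> space (P n)\<close> by (auto simp: indicator_def not_less)
      qed
    qed (use int intS in auto)
    also have "\<dots> = r / 2 + 2 * prob ?S"
      by (subst Bochner_Integration.integral_add) (auto simp: prob_space intro!: integrable_mult_right integrable_real_indicator simp: emeasure_eq_measure)
    finally show ?case using elim(1) by simp
  qed
  then show "\<exists>N. \<forall>n\<ge>N. norm ((\<integral>\<omega>. g (Z n \<omega>) \<partial>P n) - g c) < r"
    by (simp add: eventually_sequentially)
qed

lemma dist_sq_nonneg: "0 \<le> dot d x x + dot d y y - 2 * dot d x y"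
  unfolding dot_diff_self[symmetric] by (rule dot_nonneg)

section \<open>The limiting normal law\<close>

lemma real_distribution_normal:
  "\<sigma> > 0 \<Longrightarrow> real_distribution (density lborel (normal_density 0 \<sigma>))"
  using prob_space_normal_density[of \<sigma> 0] by (simp add: real_distribution_def real_distribution_axioms_def)

text \<open>The substitution of \<open>\<sigma> * x\<close> for \<open>x\<close> reduces this to the
  standard normal law.\<close>

lemma char_normal:
  assumes "\<sigma> > 0"
  shows "char (density lborel (normal_density 0 \<sigma>)) t = exp (- (\<sigma> * t)\<^sup>2 / 2)"
proof -
  have dens: "\<sigma> * normal_density 0 \<sigma> (\<sigma> * x) = std_normal_density x" for x
    using assms by (simp add: normal_density_def real_sqrt_mult power_mult_distrib)
  have "char (density lborel (normal_density 0 \<sigma>)) t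
      = (CLINT x|lborel. normal_density 0 \<sigma> x *\<^sub>R iexp (t * x))"
    unfolding char_def using assms by (subst integral_density) (auto simp: normal_density_nonneg)
  also have "\<dots> = \<sigma> *\<^sub>R (CLINT x|lborel. normal_density 0 \<sigma> (\<sigma> * x) *\<^sub>R iexp (t * (\<sigma> * x)))"
    using assms by (subst lborel_integral_real_affine[where c=\<sigma> and t=0]) (auto simp del: integral_scaleR_right)
  also have "\<dots> = (CLINT x|lborel. std_normal_density x *\<^sub>R iexp ((\<sigma> * t) * x))"
    by (simp add: mult_ac flip: dens integral_scaleR_right)
  also have "\<dots> = char std_normal_distribution (\<sigma> * t)"
    unfolding char_def by (subst integral_density) (auto simp: normal_density_nonneg)
  finally show ?thesis by (simp add: char_std_normal_distribution)
qed

text \<open>The Lipschitz constant is the maximum of the density, which is attained at the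
  mean.\<close>

lemma cdf_normal_lipschitz:
  assumes "\<sigma> > 0" "x \<le> y"
  defines "N \<equiv> density lborel (normal_density 0 \<sigma>)"
  shows "cdf N y - cdf N x \<le> 1 / sqrt (2 * pi * \<sigma>\<^sup>2) * (y - x)"
proof (cases "x = y")
  case False
  interpret real_distribution N
    unfolding N_def by (rule real_distribution_normal) fact
  have "emeasure N {x<..y} = (\<integral>\<^sup>+z. ennreal (normal_density 0 \<sigma> z) * indicator {x<..y} z \<partial>lborel)"
    unfolding N_def by (subst emeasure_density) auto
  also have "\<dots> \<le> (\<integral>\<^sup>+z. ennreal (1 / sqrt (2 * pi * \<sigma>\<^sup>2)) * indicator {x<..y} z \<partial>lborel)"
    by (intro nn_integral_mono mult_right_mono ennreal_leI)
       (auto simp: normal_density_def intro!: divide_right_mono)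
  also have "\<dots> = ennreal (1 / sqrt (2 * pi * \<sigma>\<^sup>2) * (y - x))"
    using \<open>x \<le> y\<close> by (subst nn_integral_cmult_indicator) (auto simp flip: ennreal_mult)
  finally have "measure N {x<..y} \<le> 1 / sqrt (2 * pi * \<sigma>\<^sup>2) * (y - x)"
    using \<open>x \<le> y\<close> by (simp add: emeasure_eq_measure)
  then show ?thesis
    using False \<open>x \<le> y\<close> by (simp add: cdf_diff_eq)
qed simp

section \<open>The conditional distribution function\<close>

text \<open>Writing the distribution function as an integral over the law of \<open>X\<close> gives
  its measurability in \<xi> and makes it the inner integral when Fubini is applied to the joint
  law.\<close>

lemma cdf_cond_law:
  assumes [measurable]: "X \<in> measurable M (lborel_R d)"
  shows "cdf (cond_law M d X \<xi>) y = (\<integral>x. indicat_real {..y} (dot d \<xi> x) \<partial>distr M (lborel_R d) X)"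
proof -
  have "cdf (cond_law M d X \<xi>) y = (\<integral>z. indicat_real {..y} z \<partial>distr M borel (\<lambda>\<omega>. dot d \<xi> (X \<omega>)))"
    by (simp add: cdf_def cond_law_def)
  also have "\<dots> = (\<integral>\<omega>. indicat_real {..y} (dot d \<xi> (X \<omega>)) \<partial>M)"
    by (rule integral_distr) measurable
  also have "\<dots> = (\<integral>x. indicat_real {..y} (dot d \<xi> x) \<partial>distr M (lborel_R d) X)"
    by (rule integral_distr[symmetric]) measurable
  finally show ?thesis .
qed

lemma borel_measurable_cdf_cond_law:
  assumes "prob_space M" and [measurable]: "X \<in> measurable M (lborel_R d)"
  shows "(\<lambda>\<xi>. cdf (cond_law M d X \<xi>) y) \<in> borel_measurable (lborel_R d)"
proof -
  interpret prob_space "distr M (lborel_R d) X"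
    by (rule prob_space.prob_space_distr) fact+
  show ?thesis
    unfolding cdf_cond_law[OF assms(2)] by measurable
qed

text \<open>The right-hand side is a measurable function of \<Xi>, so it suffices to compare
  integrals over events on which \<Xi> lies in a measurable set \<open>B\<close>. By independence
  the joint law is a product, and Fubini turns the integral of the indicator into that of the
  distribution function of the projection.\<close>

lemma cond_cdf_dot:
  assumes "prob_space M" and indep: "prob_space.indep_var M (lborel_R d) \<Xi> (lborel_R d) X"
    and Y: "\<And>\<omega>. \<omega> \<in> space M \<Longrightarrow> Y \<omega> = dot d (\<Xi> \<omega>) (X \<omega>)"
  shows "AE \<omega> in M. cond_cdf M (lborel_R d) \<Xi> Y y \<omega> = cdf (cond_law M d X (\<Xi> \<omega>)) y"
proof -
  interpret prob_space M by fact
  have \<Xi>[measurable]: "\<Xi> \<in> measurable M (lborel_R d)" and X[measurable]: "X \<in> measurable M (lborel_R d)"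
    and joint: "distr M (lborel_R d) \<Xi> \<Otimes>\<^sub>M distr M (lborel_R d) X
      = distr M (lborel_R d \<Otimes>\<^sub>M lborel_R d) (\<lambda>\<omega>. (\<Xi> \<omega>, X \<omega>))"
    using indep unfolding indep_var_distribution_eq by auto
  let ?F = "vimage_algebra (space M) \<Xi> (lborel_R d)"
  interpret D\<Xi>: prob_space "distr M (lborel_R d) \<Xi>" by (rule prob_space_distr) measurable
  interpret DX: prob_space "distr M (lborel_R d) X" by (rule prob_space_distr) measurable
  interpret D: pair_prob_space "distr M (lborel_R d) \<Xi>" "distr M (lborel_R d) X" ..
  have Pi: "\<Xi> \<in> space M \<rightarrow> space (lborel_R d)"
    using measurable_space[OF \<Xi>] by blast
  have sub: "subalgebra M ?F"
    by (auto simp: subalgebra_def sets_vimage_algebra2[OF Pi] intro!: measurable_sets[OF \<Xi>])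
  interpret finite_measure_subalgebra M ?F
    by unfold_locales (rule sub)
  note cdf_eq = cdf_cond_law[OF X]
  have G[measurable]: "(\<lambda>\<xi>. cdf (cond_law M d X \<xi>) y) \<in> borel_measurable (lborel_R d)"
    by (rule borel_measurable_cdf_cond_law) (fact, measurable)
  have bound: "\<bar>cdf (cond_law M d X \<xi>) y\<bar> \<le> 1" for \<xi>
  proof -
    interpret C: real_distribution "cond_law M d X \<xi>"
      by (rule real_distribution_cond_law) (fact, measurable)
    show ?thesis using C.cdf_nonneg C.cdf_bounded_prob by simp
  qed
  have Y_sets[measurable]: "{\<omega>\<in>space M. Y \<omega> \<le> y} \<in> sets M"
  proof -
    have "{\<omega>\<in>space M. Y \<omega> \<le> y} = {\<omega>\<in>space M. dot d (\<Xi> \<omega>) (X \<omega>) \<le> y}" using Y by auto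
    then show ?thesis by simp
  qed
  show ?thesis
    unfolding cond_cdf_def
  proof (rule real_cond_exp_charact)
    fix A assume "A \<in> sets ?F"
    then obtain B where B[measurable]: "B \<in> sets (lborel_R d)" and A: "A = \<Xi> -` B \<inter> space M"
      by (auto simp: sets_vimage_algebra2[OF Pi])
    have "(\<integral>\<omega>\<in>A. indicat_real {\<omega>\<in>space M. Y \<omega> \<le> y} \<omega> \<partial>M)
        = (\<integral>\<omega>. indicat_real B (\<Xi> \<omega>) * indicat_real {..y} (dot d (\<Xi> \<omega>) (X \<omega>)) \<partial>M)"
      unfolding set_lebesgue_integral_def A
      by (intro Bochner_Integration.integral_cong) (auto simp: indicator_def Y)
    also have "\<dots> = (\<integral>p. indicat_real B (fst p) * indicat_real {..y} (dot d (fst p) (snd p))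
        \<partial>distr M (lborel_R d \<Otimes>\<^sub>M lborel_R d) (\<lambda>\<omega>. (\<Xi> \<omega>, X \<omega>)))"
      by (subst integral_distr) auto
    also have "\<dots> = (\<integral>\<xi>. \<integral>x. indicat_real B \<xi> * indicat_real {..y} (dot d \<xi> x)
        \<partial>distr M (lborel_R d) X \<partial>distr M (lborel_R d) \<Xi>)"
      unfolding joint[symmetric]
      by (subst D.integral_fst'[symmetric])
         (auto intro!: D.P.integrable_const_bound[where B=1] simp: indicator_def)
    also have "\<dots> = (\<integral>\<xi>. indicat_real B \<xi> * cdf (cond_law M d X \<xi>) y \<partial>distr M (lborel_R d) \<Xi>)"
      by (simp add: cdf_eq)
    also have "\<dots> = (\<integral>\<omega>. indicat_real B (\<Xi> \<omega>) * cdf (cond_law M d X (\<Xi> \<omega>)) y \<partial>M)"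
      by (subst integral_distr) auto
    also have "\<dots> = (\<integral>\<omega>\<in>A. cdf (cond_law M d X (\<Xi> \<omega>)) y \<partial>M)"
      unfolding set_lebesgue_integral_def A
      by (intro Bochner_Integration.integral_cong) (auto simp: indicator_def)
    finally show "(\<integral>\<omega>\<in>A. indicat_real {\<omega>\<in>space M. Y \<omega> \<le> y} \<omega> \<partial>M)
      = (\<integral>\<omega>\<in>A. cdf (cond_law M d X (\<Xi> \<omega>)) y \<partial>M)" .
  next
    show "integrable M (\<lambda>\<omega>. cdf (cond_law M d X (\<Xi> \<omega>)) y)"
    proof (rule integrable_const_bound)
      show "AE \<omega> in M. norm (cdf (cond_law M d X (\<Xi> \<omega>)) y) \<le> 1"
        by (simp only: real_norm_def bound) simp
      show "(\<lambda>\<omega>. cdf (cond_law M d X (\<Xi> \<omega>)) y) \<in> borel_measurable M"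
        by (rule measurable_compose[OF \<Xi> G])
    qed
    show "integrable M (indicat_real {\<omega>\<in>space M. Y \<omega> \<le> y})"
      using Y_sets by (intro integrable_real_indicator) (simp_all add: emeasure_eq_measure)
    show "(\<lambda>\<omega>. cdf (cond_law M d X (\<Xi> \<omega>)) y) \<in> borel_measurable ?F"
      by (rule measurable_compose[OF measurable_vimage_algebra1[OF Pi] G])
  qed
qed

section \<open>Convergence of the characteristic functions of the projections\<close>

context
  fixes M :: "'a measure" and d :: "nat \<Rightarrow> nat" and X :: "nat \<Rightarrow> 'a \<Rightarrow> nat \<Rightarrow> real" and \<sigma> :: real
  assumes prob_M: "prob_space M"
    and X: "\<And>n. n \<ge> 1 \<Longrightarrow> X n \<in> measurable M (lborel_R (d n))"
    and norm_lim: "tendsto_in_prob (\<lambda>_. M) (\<lambda>n \<omega>. dot (d n) (X n \<omega>) (X n \<omega>)) (\<sigma>\<^sup>2)"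
    and dot_lim: "tendsto_in_prob (\<lambda>_. M \<Otimes>\<^sub>M M) (\<lambda>n (\<omega>, \<omega>'). dot (d n) (X n \<omega>) (X n \<omega>')) 0"
begin

interpretation M: prob_space M by (rule prob_M)
interpretation MM: pair_prob_space M M ..

text \<open>Prepares a union bound. If all three deviations are small, the total is at most
  \<open>2 * (e / 4) + 2 * (e / 8)\<close>, which is at most \<open>e\<close> because
  \<open>e\<close> is then nonnegative.\<close>

lemma abs_gt_imp_summand_gt:
  fixes a b c s e :: real
  assumes "\<bar>a + b - 2 * c - 2 * s\<bar> > e"
  shows "\<bar>a - s\<bar> > e / 4 \<or> \<bar>b - s\<bar> > e / 4 \<or> \<bar>c\<bar> > e / 8"
proof (rule ccontr)
  assume "\<not> ?thesis"
  then have "\<bar>a - s\<bar> \<le> e / 4" "\<bar>b - s\<bar> \<le> e / 4" "\<bar>c\<bar> \<le> e / 8"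
    by (simp_all only: not_less de_Morgan_disj)
  then have "a - s \<le> e / 4" "s - a \<le> e / 4" "b - s \<le> e / 4" "s - b \<le> e / 4" "c \<le> e / 8" "- c \<le> e / 8"
    unfolding abs_le_iff by simp_all
  then have "a + b - 2 * c - 2 * s \<le> e" "- (a + b - 2 * c - 2 * s) \<le> e"
    by linarith+
  then have "\<bar>a + b - 2 * c - 2 * s\<bar> \<le> e"
    by (rule abs_leI)
  with assms show False
    by (meson leD)
qed

text \<open>The expression is the squared distance of two independent copies. A large deviation of
  it forces one in either squared norm or in the inner product; the events for the norms are
  cylinders over one factor, so each has the same probability as in \<open>M\<close>.\<close>

lemma dist_sq_tendsto_in_prob:
  "tendsto_in_prob (\<lambda>_. M \<Otimes>\<^sub>M M) (\<lambda>n (\<omega>, \<omega>'). dot (d n) (X n \<omega>) (X n \<omega>) + dot (d n) (X n \<omega>') (X n \<omega>')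
     - 2 * dot (d n) (X n \<omega>) (X n \<omega>')) (2 * \<sigma>\<^sup>2)"
  unfolding tendsto_in_prob_def
proof (intro allI impI)
  fix e :: real assume "e > 0"
  let ?P = "M \<Otimes>\<^sub>M M"
  define A where "A n = {\<omega>\<in>space M. \<bar>dot (d n) (X n \<omega>) (X n \<omega>) - \<sigma>\<^sup>2\<bar> > e / 4}" for n
  define B where "B n = {p\<in>space ?P. \<bar>(case p of (\<omega>, \<omega>') \<Rightarrow> dot (d n) (X n \<omega>) (X n \<omega>')) - 0\<bar> > e / 8}" for n
  let ?C = "\<lambda>n. {p\<in>space ?P. \<bar>(case p of (\<omega>, \<omega>') \<Rightarrow> dot (d n) (X n \<omega>) (X n \<omega>) + dot (d n) (X n \<omega>') (X n \<omega>')
     - 2 * dot (d n) (X n \<omega>) (X n \<omega>')) - 2 * \<sigma>\<^sup>2\<bar> > e}"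
  have "(\<lambda>n. measure M (A n) + measure M (A n) + measure ?P (B n)) \<longlonglongrightarrow> 0 + 0 + 0"
    unfolding A_def B_def
    by (intro tendsto_add norm_lim[unfolded tendsto_in_prob_def, rule_format]
        dot_lim[unfolded tendsto_in_prob_def, rule_format]) (use \<open>e > 0\<close> in auto)
  moreover have "eventually (\<lambda>n. measure ?P (?C n) \<le> measure M (A n) + measure M (A n) + measure ?P (B n)) sequentially"
    using eventually_ge_at_top[of 1]
  proof eventually_elim
    case (elim n)
    note [measurable] = X[OF elim]
    have A: "A n \<in> sets M" and B: "B n \<in> sets ?P"
      unfolding A_def B_def by (simp_all add: case_prod_beta')
    have "measure ?P (?C n) \<le> measure ?P ((A n \<times> space M \<union> space M \<times> A n) \<union> B n)"
    proof (rule MM.P.finite_measure_mono)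
      show "?C n \<subseteq> (A n \<times> space M \<union> space M \<times> A n) \<union> B n"
      proof
        fix p assume "p \<in> ?C n"
        obtain \<omega> \<omega>' where p: "p = (\<omega>, \<omega>')" by (cases p)
        have gt: "\<bar>dot (d n) (X n \<omega>) (X n \<omega>) + dot (d n) (X n \<omega>') (X n \<omega>')
            - 2 * dot (d n) (X n \<omega>) (X n \<omega>') - 2 * \<sigma>\<^sup>2\<bar> > e"
          and sp: "\<omega> \<in> space M" "\<omega>' \<in> space M"
          using \<open>p \<in> ?C n\<close>
          by (simp_all only: p space_pair_measure mem_Collect_eq prod.case mem_Times_iff fst_conv snd_conv)
        have "\<bar>dot (d n) (X n \<omega>) (X n \<omega>) - \<sigma>\<^sup>2\<bar> > e / 4 \<or> \<bar>dot (d n) (X n \<omega>') (X n \<omega>') - \<sigma>\<^sup>2\<bar> > e / 4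
            \<or> \<bar>dot (d n) (X n \<omega>) (X n \<omega>')\<bar> > e / 8"
          by (rule abs_gt_imp_summand_gt[OF gt])
        with sp show "p \<in> (A n \<times> space M \<union> space M \<times> A n) \<union> B n"
          unfolding A_def B_def p space_pair_measure by simp
      qed
      show "(A n \<times> space M \<union> space M \<times> A n) \<union> B n \<in> sets ?P"
        using A B by auto
    qed
    also have "\<dots> \<le> measure ?P (A n \<times> space M \<union> space M \<times> A n) + measure ?P (B n)"
      by (rule measure_Un_le) (use A B in auto)
    also have "measure ?P (A n \<times> space M \<union> space M \<times> A n)
        \<le> measure ?P (A n \<times> space M) + measure ?P (space M \<times> A n)"
      by (rule measure_Un_le) (use A in auto)
    also have "measure ?P (A n \<times> space M) = measure M (A n)"
      using A M.emeasure_space_1 by (simp add: measure_def M.emeasure_pair_measure_Times)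
    also have "measure ?P (space M \<times> A n) = measure M (A n)"
      using A M.emeasure_space_1 by (simp add: measure_def M.emeasure_pair_measure_Times)
    finally show ?case by simp
  qed
  moreover have "eventually (\<lambda>n. 0 \<le> measure ?P (?C n)) sequentially"
    by (intro always_eventually allI measure_nonneg)
  ultimately show "(\<lambda>n. measure ?P (?C n)) \<longlonglongrightarrow> 0"
    unfolding add_0 by (rule_tac tendsto_sandwich[OF _ _ tendsto_const])
qed

text \<open>In the mean square formula the two integrals tend to \<open>c\<^sup>2\<close> and
  \<open>c\<close>, so the limit is \<open>c\<^sup>2 - 2 * c * c + c\<^sup>2\<close>.\<close>

lemma char_cond_law_L2_tendsto:
  "(\<lambda>n. \<integral>\<xi>. (cmod (char (cond_law M (d n) (X n) \<xi>) t - exp (- (\<sigma> * t)\<^sup>2 / 2)))\<^sup>2 \<partial>std_normal_R (d n)) \<longlonglongrightarrow> 0"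
proof -
  define c where "c = exp (- (\<sigma> * t)\<^sup>2 / 2)"
  \<comment> \<open>The absolute value bounds \<open>g\<close> by 1 on the whole line; it disappears
    at the end since \<open>g\<close> is evaluated only at squared norms and squared
    distances.\<close>
  define g where "g u = exp (- (t\<^sup>2 / 2 * \<bar>u\<bar>))" for u :: real
  have g: "isCont g u" "\<bar>g u\<bar> \<le> 1" "g \<in> borel_measurable borel" for u
    unfolding g_def by (auto intro!: continuous_intros)
  have "(\<lambda>n. \<integral>\<omega>. g (dot (d n) (X n \<omega>) (X n \<omega>)) \<partial>M) \<longlonglongrightarrow> g (\<sigma>\<^sup>2)"
    by (intro tendsto_in_prob_integral norm_lim g prob_M borel_measurable_dot X)
  moreover have "(\<lambda>n. \<integral>p. g (case p of (\<omega>, \<omega>') \<Rightarrow> dot (d n) (X n \<omega>) (X n \<omega>) + dot (d n) (X n \<omega>') (X n \<omega>')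
     - 2 * dot (d n) (X n \<omega>) (X n \<omega>')) \<partial>(M \<Otimes>\<^sub>M M)) \<longlonglongrightarrow> g (2 * \<sigma>\<^sup>2)"
  proof (rule tendsto_in_prob_integral[OF MM.P.prob_space_axioms _ dist_sq_tendsto_in_prob g(1) g(3) g(2)])
    fix n :: nat assume "n \<ge> 1"
    note [measurable] = X[OF this]
    show "(\<lambda>(\<omega>, \<omega>'). dot (d n) (X n \<omega>) (X n \<omega>) + dot (d n) (X n \<omega>') (X n \<omega>')
     - 2 * dot (d n) (X n \<omega>) (X n \<omega>')) \<in> borel_measurable (M \<Otimes>\<^sub>M M)"
      by measurable
  qed
  ultimately have "(\<lambda>n. (\<integral>p. g (case p of (\<omega>, \<omega>') \<Rightarrow> dot (d n) (X n \<omega>) (X n \<omega>) + dot (d n) (X n \<omega>') (X n \<omega>')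
     - 2 * dot (d n) (X n \<omega>) (X n \<omega>')) \<partial>(M \<Otimes>\<^sub>M M)) - 2 * c * (\<integral>\<omega>. g (dot (d n) (X n \<omega>) (X n \<omega>)) \<partial>M) + c\<^sup>2)
     \<longlonglongrightarrow> g (2 * \<sigma>\<^sup>2) - 2 * c * g (\<sigma>\<^sup>2) + c\<^sup>2"
    by (intro tendsto_intros)
  also have "g (2 * \<sigma>\<^sup>2) - 2 * c * g (\<sigma>\<^sup>2) + c\<^sup>2 = 0"
  proof -
    have "g (\<sigma>\<^sup>2) = c"
      unfolding g_def c_def by (rule arg_cong[where f=exp]) (simp add: power_mult_distrib)
    moreover have "g (2 * \<sigma>\<^sup>2) = c\<^sup>2"
      unfolding g_def c_def exp_double[symmetric] by (rule arg_cong[where f=exp]) (simp add: power_mult_distrib)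
    ultimately show ?thesis by (simp add: power2_eq_square)
  qed
  finally show ?thesis
  proof (rule Lim_transform_eventually)
    show "eventually (\<lambda>n. (\<integral>p. g (case p of (\<omega>, \<omega>') \<Rightarrow> dot (d n) (X n \<omega>) (X n \<omega>) + dot (d n) (X n \<omega>') (X n \<omega>')
     - 2 * dot (d n) (X n \<omega>) (X n \<omega>')) \<partial>(M \<Otimes>\<^sub>M M)) - 2 * c * (\<integral>\<omega>. g (dot (d n) (X n \<omega>) (X n \<omega>)) \<partial>M) + c\<^sup>2
     = (\<integral>\<xi>. (cmod (char (cond_law M (d n) (X n) \<xi>) t - exp (- (\<sigma> * t)\<^sup>2 / 2)))\<^sup>2 \<partial>std_normal_R (d n))) sequentially"
      using eventually_ge_at_top[of 1]
    proof eventually_elim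
      case (elim n)
      show ?case
        unfolding char_cond_law_L2[OF prob_M X[OF elim]] c_def[symmetric] g_def
        by (simp only: case_prod_beta' abs_of_nonneg[OF dot_nonneg] abs_of_nonneg[OF dist_sq_nonneg])
    qed
  qed
qed

lemma cmod_char_cond_law_diff:
  assumes "n \<ge> 1"
  shows "cmod (char (cond_law M (d n) (X n) \<xi>) t - exp (- (\<sigma> * t)\<^sup>2 / 2)) \<le> 2"
proof -
  have "norm (complex_of_real (exp (- (\<sigma> * t)\<^sup>2 / 2))) \<le> 1"
    by (simp only: norm_of_real abs_exp_cancel exp_le_one_iff) simp
  then show ?thesis
    using norm_triangle_ineq4[of "char (cond_law M (d n) (X n) \<xi>) t" "complex_of_real (exp (- (\<sigma> * t)\<^sup>2 / 2))"]
      cmod_char_cond_law[OF prob_M X[OF assms], of \<xi> t] by linarith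
qed

text \<open>Nonnegativity of the variance bounds the mean by the root of the mean square.\<close>

lemma char_cond_law_L1_tendsto:
  "(\<lambda>n. \<integral>\<xi>. cmod (char (cond_law M (d n) (X n) \<xi>) t - exp (- (\<sigma> * t)\<^sup>2 / 2)) \<partial>std_normal_R (d n)) \<longlonglongrightarrow> 0"
proof -
  let ?f = "\<lambda>n \<xi>. cmod (char (cond_law M (d n) (X n) \<xi>) t - exp (- (\<sigma> * t)\<^sup>2 / 2))"
  have "(\<lambda>n. sqrt (\<integral>\<xi>. (?f n \<xi>)\<^sup>2 \<partial>std_normal_R (d n))) \<longlonglongrightarrow> sqrt 0"
    by (rule tendsto_real_sqrt[OF char_cond_law_L2_tendsto])
  moreover have "eventually (\<lambda>n. (\<integral>\<xi>. ?f n \<xi> \<partial>std_normal_R (d n))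
      \<le> sqrt (\<integral>\<xi>. (?f n \<xi>)\<^sup>2 \<partial>std_normal_R (d n))) sequentially"
    using eventually_ge_at_top[of 1]
  proof eventually_elim
    case (elim n)
    interpret G: prob_space "std_normal_R (d n)" by (rule prob_space_std_normal_R)
    note [measurable] = char_cond_law_measurable'[OF prob_M X[OF elim]]
    note le = cmod_char_cond_law_diff[OF elim]
    have int: "integrable (std_normal_R (d n)) (?f n)"
    proof (rule G.integrable_const_bound[where B=2])
      show "AE \<xi> in std_normal_R (d n). norm (?f n \<xi>) \<le> 2"
        unfolding real_norm_def abs_norm_cancel by (intro always_eventually allI le)
    qed measurable
    have int2: "integrable (std_normal_R (d n)) (\<lambda>\<xi>. (?f n \<xi>)\<^sup>2)"
    proof (rule G.integrable_const_bound[where B="2\<^sup>2"])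
      show "AE \<xi> in std_normal_R (d n). norm ((?f n \<xi>)\<^sup>2) \<le> 2\<^sup>2"
        unfolding real_norm_def abs_power2 by (intro always_eventually allI power_mono le norm_ge_zero)
    qed measurable
    have "0 \<le> G.variance (?f n)" by (rule G.variance_positive)
    also have "\<dots> = (\<integral>\<xi>. (?f n \<xi>)\<^sup>2 \<partial>std_normal_R (d n)) - (\<integral>\<xi>. ?f n \<xi> \<partial>std_normal_R (d n))\<^sup>2"
      by (rule G.variance_eq[OF int int2])
    finally have "(\<integral>\<xi>. ?f n \<xi> \<partial>std_normal_R (d n))\<^sup>2 \<le> (\<integral>\<xi>. (?f n \<xi>)\<^sup>2 \<partial>std_normal_R (d n))"
      by simp
    then show ?case by (rule real_le_rsqrt)
  qed
  moreover have "eventually (\<lambda>n. 0 \<le> (\<integral>\<xi>. ?f n \<xi> \<partial>std_normal_R (d n))) sequentially"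
    by (intro always_eventually allI Bochner_Integration.integral_nonneg norm_ge_zero)
  ultimately show ?thesis
    unfolding real_sqrt_zero by (rule_tac tendsto_sandwich[OF _ _ tendsto_const])
qed

text \<open>After exchanging the integrals, the inner average over \<xi> tends to 0 for every
  \<open>t\<close>, and twice the Gaussian weight of the smoothing inequality dominates it, so
  dominated convergence applies.\<close>

lemma weighted_char_cond_law_tendsto:
  assumes "\<epsilon> > 0"
  shows "(\<lambda>n. \<integral>\<xi>. \<integral>t. cmod (char (cond_law M (d n) (X n) \<xi>) t - exp (- (\<sigma> * t)\<^sup>2 / 2))
           * exp (- (\<epsilon> * t)\<^sup>2 / 2) \<partial>lborel \<partial>std_normal_R (d n)) \<longlonglongrightarrow> 0"
    and "n \<ge> 1 \<Longrightarrow> integrable (std_normal_R (d n)) (\<lambda>\<xi>. \<integral>t. cmod (char (cond_law M (d n) (X n) \<xi>) t - exp (- (\<sigma> * t)\<^sup>2 / 2))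
           * exp (- (\<epsilon> * t)\<^sup>2 / 2) \<partial>lborel)"
proof -
  define w where "w t = exp (- (\<epsilon> * t)\<^sup>2 / 2)" for t
  define f where "f n \<xi> t = cmod (char (cond_law M (d n) (X n) \<xi>) t - exp (- (\<sigma> * t)\<^sup>2 / 2)) * w t" for n \<xi> t
  have w: "integrable lborel w" "\<And>t. 0 \<le> w t" and w_meas[measurable]: "w \<in> borel_measurable lborel"
    using integrable_exp_minus_square[OF assms] unfolding w_def by auto
  have w2: "integrable lborel (\<lambda>t. 2 * w t)"
    using w by simp
  have f_nonneg: "0 \<le> f n \<xi> t" for n \<xi> t
    unfolding f_def by (intro mult_nonneg_nonneg w norm_ge_zero)
  have f_le: "f n \<xi> t \<le> 2 * w t" if "n \<ge> 1" for n \<xi> t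
    unfolding f_def by (intro mult_right_mono w cmod_char_cond_law_diff that)
  have f_meas: "(\<lambda>p. f n (fst p) (snd p)) \<in> borel_measurable (std_normal_R (d n) \<Otimes>\<^sub>M lborel)" if "n \<ge> 1" for n
  proof -
    note [measurable] = char_cond_law_measurable[OF prob_M X[OF that]]
    show ?thesis unfolding f_def by measurable
  qed
  have int_t: "integrable lborel (f n \<xi>)" if "n \<ge> 1" for n \<xi>
  proof (rule Bochner_Integration.integrable_bound[OF w2])
    show "f n \<xi> \<in> borel_measurable lborel"
      using real_distribution.char_measurable[OF real_distribution_cond_law[OF prob_M X[OF that]]]
      unfolding f_def by measurable
    show "AE t in lborel. norm (f n \<xi> t) \<le> norm (2 * w t)"
      using f_le[OF that] f_nonneg w(2) by (intro always_eventually allI) simp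
  qed
  have int_le: "(\<integral>t. f n \<xi> t \<partial>lborel) \<le> (\<integral>t. 2 * w t \<partial>lborel)" if "n \<ge> 1" for n \<xi>
    by (intro integral_mono int_t w2 f_le that)
  have int_nonneg: "0 \<le> (\<integral>t. f n \<xi> t \<partial>lborel)" for n \<xi>
    by (intro Bochner_Integration.integral_nonneg f_nonneg)
  have int_\<xi>: "integrable (std_normal_R (d n)) (\<lambda>\<xi>. \<integral>t. f n \<xi> t \<partial>lborel)" if "n \<ge> 1" for n
  proof -
    interpret G: prob_space "std_normal_R (d n)" by (rule prob_space_std_normal_R)
    show ?thesis
    proof (rule G.integrable_const_bound)
      show "AE \<xi> in std_normal_R (d n). norm (\<integral>t. f n \<xi> t \<partial>lborel) \<le> (\<integral>t. 2 * w t \<partial>lborel)"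
        unfolding real_norm_def abs_of_nonneg[OF int_nonneg]
        by (intro always_eventually allI int_le that)
      show "(\<lambda>\<xi>. \<integral>t. f n \<xi> t \<partial>lborel) \<in> borel_measurable (std_normal_R (d n))"
        using f_meas[OF that] by (intro lborel.borel_measurable_lebesgue_integral) (simp add: case_prod_beta')
    qed
  qed
  then show "n \<ge> 1 \<Longrightarrow> integrable (std_normal_R (d n)) (\<lambda>\<xi>. \<integral>t. cmod (char (cond_law M (d n) (X n) \<xi>) t - exp (- (\<sigma> * t)\<^sup>2 / 2))
           * exp (- (\<epsilon> * t)\<^sup>2 / 2) \<partial>lborel)"
    unfolding f_def w_def .
  define h where "h n t = (\<integral>\<xi>. f n \<xi> t \<partial>std_normal_R (d n))" for n t
  have swap: "(\<integral>\<xi>. \<integral>t. f n \<xi> t \<partial>lborel \<partial>std_normal_R (d n)) = (\<integral>t. h n t \<partial>lborel)" if "n \<ge> 1" for n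
  proof -
    interpret G: prob_space "std_normal_R (d n)" by (rule prob_space_std_normal_R)
    interpret GL: pair_sigma_finite "std_normal_R (d n)" lborel ..
    have "integrable (std_normal_R (d n) \<Otimes>\<^sub>M lborel) (\<lambda>p. f n (fst p) (snd p))"
    proof (rule GL.Fubini_integrable[OF f_meas[OF that]])
      show "integrable (std_normal_R (d n)) (\<lambda>\<xi>. \<integral>t. norm (f n (fst (\<xi>, t)) (snd (\<xi>, t))) \<partial>lborel)"
        using int_\<xi>[OF that] by (simp only: fst_conv snd_conv real_norm_def abs_of_nonneg[OF f_nonneg])
      show "AE \<xi> in std_normal_R (d n). integrable lborel (\<lambda>t. f n (fst (\<xi>, t)) (snd (\<xi>, t)))"
        using int_t[OF that] by (intro always_eventually allI) (simp only: fst_conv snd_conv)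
    qed
    then have "(\<integral>t. \<integral>\<xi>. f n \<xi> t \<partial>std_normal_R (d n) \<partial>lborel) = (\<integral>\<xi>. \<integral>t. f n \<xi> t \<partial>lborel \<partial>std_normal_R (d n))"
      by (intro GL.Fubini_integral) (simp only: case_prod_beta')
    then show ?thesis by (simp only: h_def)
  qed
  have h_le: "norm (h n t) \<le> 2 * w t" if "n \<ge> 1" for n t
  proof -
    interpret G: prob_space "std_normal_R (d n)" by (rule prob_space_std_normal_R)
    note [measurable] = char_cond_law_measurable'[OF prob_M X[OF that], of t]
    have "integrable (std_normal_R (d n)) (\<lambda>\<xi>. f n \<xi> t)"
    proof (rule G.integrable_const_bound)
      show "AE \<xi> in std_normal_R (d n). norm (f n \<xi> t) \<le> 2 * w t"
        unfolding real_norm_def abs_of_nonneg[OF f_nonneg] by (intro always_eventually allI f_le that)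
      show "(\<lambda>\<xi>. f n \<xi> t) \<in> borel_measurable (std_normal_R (d n))"
        unfolding f_def by measurable
    qed
    then have "h n t \<le> (\<integral>\<xi>. 2 * w t \<partial>std_normal_R (d n))"
      unfolding h_def by (intro integral_mono f_le that) simp_all
    moreover have "0 \<le> h n t"
      unfolding h_def by (intro Bochner_Integration.integral_nonneg f_nonneg)
    ultimately show ?thesis by (simp add: G.prob_space)
  qed
  have h_meas: "h n \<in> borel_measurable lborel" if "n \<ge> 1" for n
  proof -
    interpret G: prob_space "std_normal_R (d n)" by (rule prob_space_std_normal_R)
    have "(\<lambda>p. f n (snd p) (fst p)) \<in> borel_measurable (lborel \<Otimes>\<^sub>M std_normal_R (d n))"
      using measurable_compose[OF measurable_pair_swap' f_meas[OF that]] by (simp add: case_prod_beta')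
    then show ?thesis
      unfolding h_def by (intro G.borel_measurable_lebesgue_integral) (simp add: case_prod_beta')
  qed
  \<comment> \<open>Dominated convergence wants measurability and domination at every index, while
    these are known from index 1 on; hence the shift.\<close>
  have "(\<lambda>n. \<integral>t. h (Suc n) t \<partial>lborel) \<longlonglongrightarrow> integral\<^sup>L lborel (\<lambda>_::real. 0 :: real)"
  proof (rule integral_dominated_convergence[where w="\<lambda>t. 2 * w t"])
    show "integrable lborel (\<lambda>t. 2 * w t)" by (rule w2)
    show "AE t in lborel. norm (h (Suc n) t) \<le> 2 * w t" for n
      by (intro always_eventually allI h_le) simp
    have "(\<lambda>n. h n t) \<longlonglongrightarrow> 0" for t
      using tendsto_mult_left[OF char_cond_law_L1_tendsto[of t], of "w t"]
      unfolding h_def f_def by (simp add: mult.commute)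
    then show "AE t in lborel. (\<lambda>n. h (Suc n) t) \<longlonglongrightarrow> 0"
      by (intro always_eventually allI LIMSEQ_Suc)
  qed (use h_meas in auto)
  then have "(\<lambda>n. \<integral>\<xi>. \<integral>t. f (Suc n) \<xi> t \<partial>lborel \<partial>std_normal_R (d (Suc n))) \<longlonglongrightarrow> 0"
    by (simp add: swap)
  then have "(\<lambda>n. \<integral>\<xi>. \<integral>t. f n \<xi> t \<partial>lborel \<partial>std_normal_R (d n)) \<longlonglongrightarrow> 0"
    by (rule LIMSEQ_imp_Suc)
  then show "(\<lambda>n. \<integral>\<xi>. \<integral>t. cmod (char (cond_law M (d n) (X n) \<xi>) t - exp (- (\<sigma> * t)\<^sup>2 / 2))
           * exp (- (\<epsilon> * t)\<^sup>2 / 2) \<partial>lborel \<partial>std_normal_R (d n)) \<longlonglongrightarrow> 0"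
    unfolding f_def w_def .
qed

end

section \<open>Moments of the distance between distribution functions\<close>

text \<open>Up to \<eta> the first summand suffices by monotonicity of the power; beyond \<eta> the
  quotient exceeds 1. In this way first moments control \<open>p\<close>-th moments for every
  positive \<open>p\<close>.\<close>

lemma powr_le_add_divide:
  fixes z \<eta> p :: real
  assumes "0 \<le> z" "z \<le> 1" "0 < \<eta>" "0 < p"
  shows "z powr p \<le> \<eta> powr p + z / \<eta>"
proof (cases "z \<le> \<eta>")
  case True
  then have "z powr p \<le> \<eta> powr p" using assms by (intro powr_mono2) auto
  moreover have "0 \<le> z / \<eta>" using assms by simp
  ultimately show ?thesis by linarith
next
  case False
  have "z powr p \<le> 1 powr p" using assms by (intro powr_mono2) auto
  also have "\<dots> \<le> z / \<eta>" using False assms by simp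
  finally show ?thesis using powr_ge_zero[of \<eta> p] by linarith
qed

theorem corollary5p2:
  fixes M :: "'a measure" and d :: "nat \<Rightarrow> nat" and k :: nat and \<sigma> :: real
    and X \<Xi> :: "nat \<Rightarrow> 'a \<Rightarrow> nat \<Rightarrow> real" and Y :: "nat \<Rightarrow> 'a \<Rightarrow> real"
  assumes "prob_space M"
    and d_pos: "\<And>n. n \<ge> 1 \<Longrightarrow> d n > 0"
    and d_mono: "mono_on {1..} d"
    and d_lim: "filterlim d at_top sequentially"
    and k: "k \<ge> 1"
    and \<sigma>: "\<sigma> > 0"
    and X: "\<And>n. n \<ge> 1 \<Longrightarrow> continuous_random_vector M (d n) (X n)"
    and c1: "tendsto_in_prob (\<lambda>_. M) (\<lambda>n \<omega>. (L2_set (X n \<omega>) {..<d n})\<^sup>2) (\<sigma>\<^sup>2)"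
    and c2: "tendsto_in_prob (\<lambda>_. M \<Otimes>\<^sub>M M) (\<lambda>n (\<omega>, \<omega>'). dot (d n) (X n \<omega>) (X n \<omega>')) 0"
    and c3: "\<exists>n\<^sub>0\<ge>1. (\<integral>\<^sup>+ \<omega>. inverse (ennreal (sqrt (Determinant.det (gram (d n\<^sub>0) k (X n\<^sub>0) \<omega>))))
                       \<partial>PiM {..<k} (\<lambda>_. M)) < \<infinity>"
    and c4: "\<And>n. n \<ge> 1 \<Longrightarrow> AE \<theta> in surface_measure (d n).
               (\<integral>\<^sup>+ t. ennreal (cmod (char_vec M (d n) (X n) (\<lambda>i\<in>{..<d n}. t * \<theta> i))) \<partial>lborel) < \<infinity>"
    and \<Xi>_meas: "\<And>n. n \<ge> 1 \<Longrightarrow> \<Xi> n \<in> measurable M (lborel_R (d n))"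
    and \<Xi>: "\<And>n. n \<ge> 1 \<Longrightarrow> distr M (lborel_R (d n)) (\<Xi> n) = std_normal_R (d n)"
    and indep: "prob_space.indep_var M
                  (PiM {1..} (\<lambda>n. lborel_R (d n))) (\<lambda>\<omega>. \<lambda>n\<in>{1..}. \<Xi> n \<omega>)
                  (PiM {1..} (\<lambda>n. lborel_R (d n))) (\<lambda>\<omega>. \<lambda>n\<in>{1..}. X n \<omega>)"
    and Y: "\<And>n \<omega>. n \<ge> 1 \<Longrightarrow> \<omega> \<in> space M \<Longrightarrow> Y n \<omega> = dot (d n) (\<Xi> n \<omega>) (X n \<omega>)"
  shows "\<forall>p::real. 0 < p \<and> p < 2 * \<lfloor>real k / 2\<rfloor> \<longrightarrow>
           (\<lambda>n. SUP y. prob_space.expectation M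
                  (\<lambda>\<omega>. \<bar>cond_cdf M (lborel_R (d n)) (\<Xi> n) (Y n) y \<omega>
                        - cdf (density lborel (normal_density 0 \<sigma>)) y\<bar> powr p))
           \<longlonglongrightarrow> 0"
proof (intro allI impI)
  fix p :: real
  assume "0 < p \<and> p < 2 * \<lfloor>real k / 2\<rfloor>"
  then have "p > 0" by simp
  interpret prob_space M by fact
  define N where "N = density lborel (normal_density 0 \<sigma>)"
  interpret N: real_distribution N
    unfolding N_def by (rule real_distribution_normal[OF \<sigma>])
  define E where "E n y = expectation (\<lambda>\<omega>. \<bar>cond_cdf M (lborel_R (d n)) (\<Xi> n) (Y n) y \<omega> - cdf N y\<bar> powr p)" for n y
  have X_meas: "X n \<in> measurable M (lborel_R (d n))" if "n \<ge> 1" for n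
    using X[OF that] unfolding continuous_random_vector_def by (blast dest: distributed_measurable)
  have norm_lim: "tendsto_in_prob (\<lambda>_. M) (\<lambda>n \<omega>. dot (d n) (X n \<omega>) (X n \<omega>)) (\<sigma>\<^sup>2)"
    using c1 by (simp only: dot_self)
  note char_lim = weighted_char_cond_law_tendsto[OF \<open>prob_space M\<close> X_meas norm_lim c2]
  define D where "D \<epsilon> n \<xi> = (\<integral>t. cmod (char (cond_law M (d n) (X n) \<xi>) t - exp (- (\<sigma> * t)\<^sup>2 / 2))
      * exp (- (\<epsilon> * t)\<^sup>2 / 2) \<partial>lborel)" for \<epsilon> n \<xi>
  \<comment> \<open>The conditional distribution function, determined only almost everywhere, is
    replaced by its explicit version, and the expectation is carried over to the Gaussian law of
    \<open>\<Xi> n\<close>.\<close>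
  have E_eq: "E n y = (\<integral>\<xi>. \<bar>cdf (cond_law M (d n) (X n) \<xi>) y - cdf N y\<bar> powr p \<partial>std_normal_R (d n))"
    if "n \<ge> 1" for n y
  proof -
    \<comment> \<open>Independence is given for the whole sequences; evaluating both at the index
      \<open>n\<close> yields the independence of \<open>\<Xi> n\<close> and
      \<open>X n\<close>.\<close>
    have comp: "(\<lambda>f. f n) \<circ> (\<lambda>\<omega>. \<lambda>n\<in>{1..}. V n \<omega>) = V n" for V :: "nat \<Rightarrow> 'a \<Rightarrow> nat \<Rightarrow> real"
      using that by auto
    have "(\<lambda>f. f n) \<in> measurable (PiM {1..} (\<lambda>n. lborel_R (d n))) (lborel_R (d n))"
      using that by (intro measurable_component_singleton) simp
    from indep_var_compose[OF indep this this]
    have ind: "indep_var (lborel_R (d n)) (\<Xi> n) (lborel_R (d n)) (X n)"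
      unfolding comp .
    note G = borel_measurable_cdf_cond_law[OF \<open>prob_space M\<close> X_meas[OF that], of y]
    have "E n y = expectation (\<lambda>\<omega>. \<bar>cdf (cond_law M (d n) (X n) (\<Xi> n \<omega>)) y - cdf N y\<bar> powr p)"
      unfolding E_def
    proof (rule integral_cong_AE)
      show "AE \<omega> in M. \<bar>cond_cdf M (lborel_R (d n)) (\<Xi> n) (Y n) y \<omega> - cdf N y\<bar> powr p
          = \<bar>cdf (cond_law M (d n) (X n) (\<Xi> n \<omega>)) y - cdf N y\<bar> powr p"
      proof -
        have "AE \<omega> in M. cond_cdf M (lborel_R (d n)) (\<Xi> n) (Y n) y \<omega> = cdf (cond_law M (d n) (X n) (\<Xi> n \<omega>)) y"
          by (rule cond_cdf_dot[OF \<open>prob_space M\<close> ind Y[OF that]])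
        then show ?thesis by eventually_elim (simp only:)
      qed
      show "(\<lambda>\<omega>. \<bar>cond_cdf M (lborel_R (d n)) (\<Xi> n) (Y n) y \<omega> - cdf N y\<bar> powr p) \<in> borel_measurable M"
        unfolding cond_cdf_def by (intro borel_measurable_cond_exp2 powr_real_measurable borel_measurable_abs
          borel_measurable_diff borel_measurable_const)
      show "(\<lambda>\<omega>. \<bar>cdf (cond_law M (d n) (X n) (\<Xi> n \<omega>)) y - cdf N y\<bar> powr p) \<in> borel_measurable M"
        by (intro powr_real_measurable borel_measurable_abs borel_measurable_diff borel_measurable_const
          measurable_compose[OF \<Xi>_meas[OF that] G])
    qed
    also have "\<dots> = (\<integral>\<xi>. \<bar>cdf (cond_law M (d n) (X n) \<xi>) y - cdf N y\<bar> powr p \<partial>distr M (lborel_R (d n)) (\<Xi> n))"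
      by (intro integral_distr[symmetric] \<Xi>_meas[OF that] powr_real_measurable borel_measurable_abs
          borel_measurable_diff borel_measurable_const G)
    finally show ?thesis unfolding \<Xi>[OF that] .
  qed
  \<comment> \<open>The right-hand side does not involve \<open>y\<close>; this is the source of the
    uniformity.\<close>
  have E_le: "E n y \<le> \<eta> powr p + (\<delta> + C * (\<integral>\<xi>. D \<epsilon> n \<xi> \<partial>std_normal_R (d n))) / \<eta>"
    if "n \<ge> 1" "\<eta> > 0" "\<epsilon> > 0"
      and bound: "\<And>M y. real_distribution M \<Longrightarrow> \<bar>cdf M y - cdf N y\<bar> \<le> \<delta> + C *
        (\<integral>t. cmod (char M t - char N t) * exp (- (\<epsilon> * t)\<^sup>2 / 2) \<partial>lborel)"
    for n y \<eta> \<delta> C \<epsilon>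
  proof -
    interpret G: prob_space "std_normal_R (d n)" by (rule prob_space_std_normal_R)
    let ?z = "\<lambda>\<xi>. \<bar>cdf (cond_law M (d n) (X n) \<xi>) y - cdf N y\<bar>"
    note law = real_distribution_cond_law[OF \<open>prob_space M\<close> X_meas[OF \<open>n \<ge> 1\<close>]]
    have intD: "integrable (std_normal_R (d n)) (D \<epsilon> n)"
      unfolding D_def by (rule char_lim(2)[OF _ \<open>\<epsilon> > 0\<close> \<open>n \<ge> 1\<close>])
    have z_le: "?z \<xi> \<le> \<delta> + C * D \<epsilon> n \<xi>" for \<xi>
      using bound[OF law, of \<xi> y] unfolding D_def N_def char_normal[OF \<sigma>] .
    have z_bound: "?z \<xi> \<le> 1" for \<xi>
    proof -
      interpret L: real_distribution "cond_law M (d n) (X n) \<xi>" by (rule law)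
      have "0 \<le> cdf (cond_law M (d n) (X n) \<xi>) y" "cdf (cond_law M (d n) (X n) \<xi>) y \<le> 1" "0 \<le> cdf N y" "cdf N y \<le> 1"
        by (rule L.cdf_nonneg L.cdf_bounded_prob N.cdf_nonneg N.cdf_bounded_prob)+
      then show ?thesis by (intro abs_leI) linarith+
    qed
    have le: "?z \<xi> powr p \<le> \<eta> powr p + (\<delta> + C * D \<epsilon> n \<xi>) / \<eta>" for \<xi>
      using powr_le_add_divide[OF abs_ge_zero z_bound \<open>\<eta> > 0\<close> \<open>p > 0\<close>, of \<xi>]
        divide_right_mono[OF z_le[of \<xi>], of \<eta>] \<open>\<eta> > 0\<close> by linarith
    have int: "integrable (std_normal_R (d n)) (\<lambda>\<xi>. \<eta> powr p + (\<delta> + C * D \<epsilon> n \<xi>) / \<eta>)"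
      using intD by simp
    have "E n y \<le> (\<integral>\<xi>. \<eta> powr p + (\<delta> + C * D \<epsilon> n \<xi>) / \<eta> \<partial>std_normal_R (d n))"
      unfolding E_eq[OF \<open>n \<ge> 1\<close>] by (rule integral_mono'[OF int le order_trans[OF powr_ge_zero le]])
    also have "\<dots> = \<eta> powr p + (\<delta> + C * (\<integral>\<xi>. D \<epsilon> n \<xi> \<partial>std_normal_R (d n))) / \<eta>"
      using intD by (simp add: G.prob_space)
    finally show ?thesis .
  qed
  have "(\<lambda>n. SUP y. E n y) \<longlonglongrightarrow> 0"
  proof (rule LIMSEQ_I)
    fix r :: real assume "r > 0"
    \<comment> \<open>Three quarters of \<open>r\<close> are spent: \<open>\<eta> powr p\<close> and
      \<open>\<delta> / \<eta>\<close> equal \<open>r / 4\<close> each, and the term with the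
      characteristic functions falls below \<open>r / 4\<close> for large \<open>n\<close>, since
      \<epsilon> and \<open>C\<close> are fixed before \<open>n\<close>.\<close>
    define \<eta> where "\<eta> = (r / 4) powr (1 / p)"
    have "\<eta> > 0" and \<eta>: "\<eta> powr p = r / 4"
      using \<open>r > 0\<close> \<open>p > 0\<close> by (auto simp: \<eta>_def powr_powr)
    define \<delta> where "\<delta> = \<eta> * r / 4"
    have "\<delta> > 0" using \<open>r > 0\<close> \<open>\<eta> > 0\<close> by (simp add: \<delta>_def)
    obtain \<epsilon> C where "\<epsilon> > 0" "C \<ge> 0"
      and bound: "\<And>M y. real_distribution M \<Longrightarrow> \<bar>cdf M y - cdf N y\<bar> \<le> \<delta> + C *
        (\<integral>t. cmod (char M t - char N t) * exp (- (\<epsilon> * t)\<^sup>2 / 2) \<partial>lborel)"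
      using cdf_diff_le_char_diff[OF real_distribution_normal[OF \<sigma>] cdf_normal_lipschitz[OF \<sigma>] \<open>\<delta> > 0\<close>]
      unfolding N_def by blast
    have "(\<lambda>n. C * (\<integral>\<xi>. D \<epsilon> n \<xi> \<partial>std_normal_R (d n)) / \<eta>) \<longlonglongrightarrow> C * 0 / \<eta>"
      unfolding D_def by (intro tendsto_intros char_lim(1)) (use \<open>\<epsilon> > 0\<close> \<open>\<eta> > 0\<close> in auto)
    then have "eventually (\<lambda>n. C * (\<integral>\<xi>. D \<epsilon> n \<xi> \<partial>std_normal_R (d n)) / \<eta> < r / 4) sequentially"
      by (rule order_tendstoD(2)) (use \<open>r > 0\<close> in simp)
    then have "eventually (\<lambda>n. norm ((SUP y. E n y) - 0) < r) sequentially"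
      using eventually_ge_at_top[of 1]
    proof eventually_elim
      case (elim n)
      have le: "E n y \<le> 3 / 4 * r" for y
      proof -
        have "(\<delta> + C * (\<integral>\<xi>. D \<epsilon> n \<xi> \<partial>std_normal_R (d n))) / \<eta>
            = r / 4 + C * (\<integral>\<xi>. D \<epsilon> n \<xi> \<partial>std_normal_R (d n)) / \<eta>"
          using \<open>\<eta> > 0\<close> by (simp add: \<delta>_def add_divide_distrib)
        then show ?thesis
          using E_le[OF elim(2) \<open>\<eta> > 0\<close> \<open>\<epsilon> > 0\<close> bound, of y] elim(1) \<eta> by linarith
      qed
      have "(SUP y. E n y) \<le> 3 / 4 * r"
        by (intro cSUP_least le) simp
      \<comment> \<open>The supremum is nonnegative because it dominates its member at 0; this needs
        the family to be bounded above, which the uniform bound supplies.\<close>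
      moreover have "0 \<le> E n 0"
        unfolding E_def by (intro Bochner_Integration.integral_nonneg powr_ge_zero)
      moreover have "E n 0 \<le> (SUP y. E n y)"
        by (intro cSUP_upper bdd_aboveI2[OF le]) simp
      ultimately show ?case using \<open>r > 0\<close> by simp
    qed
    then show "\<exists>M. \<forall>n\<ge>M. norm ((SUP y. E n y) - 0) < r"
      by (simp only: eventually_sequentially)
  qed
  then show "(\<lambda>n. SUP y. expectation (\<lambda>\<omega>. \<bar>cond_cdf M (lborel_R (d n)) (\<Xi> n) (Y n) y \<omega>
      - cdf (density lborel (normal_density 0 \<sigma>)) y\<bar> powr p)) \<longlonglongrightarrow> 0"
    unfolding E_def N_def .
qed

end
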